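(* Let $\mathbb{T}$ be a time scale, $\alpha\in(0,1]$, $t_0\in\mathbb{T}^{\kappa}$, and $\gamma\in\mathbb{R}\setminus\{0\}$. Let $\kappa_0,\kappa_1$ be an admissible pair on $\mathbb{T}$, let $\Delta^{\alpha}f=\kappa_1(\alpha,\cdot)f+\kappa_0(\alpha,\cdot)f^{\Delta}$, and suppose $\kappa_0^{2}-2\mu\kappa_0\kappa_1+\mu^{2}(\gamma^{2}+\kappa_1^{2})\neq0$ for all $t\in\mathbb{T}^\kappa$, where $\kappa_i=\kappa_i(\alpha,t)$, $\mu=\mu(t)$. Then $$y(t)=c_1\cos_{\gamma\Delta^{\alpha}}(t,t_0)+c_2\sin_{\gamma\Delta^{\alpha}}(t,t_0)$$ ($c_1,c_2$ arbitrary constants) is a general solution of $$\Delta^{\alpha}\Delta^{\alpha}y+\gamma^{2}y=0,\qquad t\in\mathbb{T}^{\kappa^2};$$ that is, every function of this form is a solution and every solution is of this form.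
   Context: A time scale $\mathbb{T}$ is a nonempty closed subset of $\mathbb{R}$, with forward jump $\sigma(t)=\inf\{s\in\mathbb{T}:s>t\}$, backward jump $\rho(t)=\sup\{s\in\mathbb{T}:s<t\}$ (usual conventions $\inf\emptyset=\sup\mathbb{T}$, $\sup\emptyset=\inf\mathbb{T}$) and graininess $\mu(t)=\sigma(t)-t$. A point $t$ is right-dense if $t<\sup\mathbb{T}$ and $\sigma(t)=t$, left-dense if $t>\inf\mathbb{T}$ and $\rho(t)=t$, left-scattered if $\rho(t)<t$. $\mathbb{T}^{\kappa}=\mathbb{T}\setminus\{m\}$ if $\mathbb{T}$ has a left-scattered maximum $m$, and $\mathbb{T}^{\kappa}=\mathbb{T}$ otherwise; $\mathbb{T}^{\kappa^2}=(\mathbb{T}^\kappa)^\kappa$. Delta derivative: for $t\in\mathbb{T}^\kappa$, $f^{\Delta}(t)$ is the number (if it exists) such that for every $\epsilon>0$ there is $\delta>0$ with $|[f(\sigma(t))-f(s)]-f^{\Delta}(t)[\sigma(t)-s]|\le\epsilon|\sigma(t)-s|$ for all $s\in(t-\delta,t+\delta)\cap\mathbb{T}$ (likewise for complex-valued functions). A function on $\mathbb{T}$ is rd-continuous if it is continuous at right-dense points and has finite left-sided limits at left-dense points. A function $k:[0,1]\times\mathbb{T}\to[0,\infty)$ is rd-continuous if $k(\alpha,\cdot)$ is rd-continuous for every $\alpha\in[0,1]$ and $k(\cdot,t)$ is continuous on $[0,1]$ for every $t\in\mathbb{T}$. Admissible pair: rd-continuous $\kappa_0,\kappa_1:[0,1]\times\mathbb{T}\to[0,\infty)$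 such that for all $t\in\mathbb{T}$: $\lim_{\alpha\to0^+}\kappa_1(\alpha,t)=1$, $\lim_{\alpha\to0^+}\kappa_0(\alpha,t)=0$, $\lim_{\alpha\to1^-}\kappa_1(\alpha,t)=0$, $\lim_{\alpha\to1^-}\kappa_0(\alpha,t)=1$, $\kappa_1(\alpha,t)\ne0$ for $\alpha\in[0,1)$, $\kappa_0(\alpha,t)\neq0$ for $\alpha\in(0,1]$. Exponentials: $e_q(t,s)=\exp\left(\int_s^t\xi_{\mu(\tau)}(q(\tau))\Delta\tau\right)$ (delta integral) denotes the usual exponential function on the time scale, with $\xi_h(z)=\frac1h\mathrm{Log}(1+hz)$ for $h>0$ ($\mathrm{Log}$ the principal logarithm) and $\xi_0(z)=z$. The conformable exponential, introduced for $s\le t$ in $\mathbb{T}$, is $E_r(t,s)=e_q(t,s)$ with $q=\frac{r-\kappa_1(\alpha,\cdot)}{\kappa_0(\alpha,\cdot)}$, where $r$ is such that $1+\mu q\neq0$ on $\mathbb{T}^\kappa$. The condition assumed in the theorem is equivalent to this nonvanishing for both $r\equiv i\gamma$ and $r\equiv-i\gamma$, and $$\cos_{\gamma\Delta^{\alpha}}(\cdot,t_0)=\frac{E_{i\gamma}(\cdot,t_0)+E_{-i\gamma}(\cdot,t_0)}{2},\qquad \sin_{\gamma\Delta^{\alpha}}(\cdot,t_0)=\frac{E_{i\gamma}(\cdot,t_0)-E_{-i\gamma}(\cdot,t_0)}{2i}.$$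
   Formalization: Added hypothesis: the exponents (±iγ−κ₁)/κ₀ are rd-continuous on the time scale and continuous at its maximum, if any; without it the exponentials may be undefined, or cos and sin may fail to solve the equation at a left-dense maximum. *)

theory Defs
  imports "HOL-Analysis.Analysis"
begin

text \<open>
  A time scale is a set \<open>T\<close> of reals; functions on it are total functions on \<open>real\<close>
  of which only the values on \<open>T\<close> matter.
\<close>

definition time_scale :: "real set \<Rightarrow> bool" where
  "time_scale T \<longleftrightarrow> closed T \<and> T \<noteq> {}"

text \<open>
  The case distinctions implement \<open>inf {} = sup T\<close> and \<open>sup {} = inf T\<close>. For \<open>t \<in> T\<close> they are
  reached only if \<open>t\<close> is the maximum (minimum) of \<open>T\<close>, so \<open>Sup T\<close> (\<open>Inf T\<close>) is a genuine real.
\<close>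

definition fwd_jump :: "real set \<Rightarrow> real \<Rightarrow> real" where
  "fwd_jump T t = (if \<exists>s\<in>T. t < s then Inf {s\<in>T. t < s} else Sup T)"

definition bwd_jump :: "real set \<Rightarrow> real \<Rightarrow> real" where
  "bwd_jump T t = (if \<exists>s\<in>T. s < t then Sup {s\<in>T. s < t} else Inf T)"

definition graininess :: "real set \<Rightarrow> real \<Rightarrow> real" where
  "graininess T t = fwd_jump T t - t"

text \<open>
  \<open>\<exists>s\<in>T. t < s\<close> says \<open>t < sup T\<close>, where the supremum may be infinite; dually for \<open>inf T\<close>.
\<close>

definition right_dense :: "real set \<Rightarrow> real \<Rightarrow> bool" where
  "right_dense T t \<longleftrightarrow> (\<exists>s\<in>T. t < s) \<and> fwd_jump T t = t"

definition left_dense :: "real set \<Rightarrow> real \<Rightarrow> bool" where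
  "left_dense T t \<longleftrightarrow> (\<exists>s\<in>T. s < t) \<and> bwd_jump T t = t"

definition left_scattered :: "real set \<Rightarrow> real \<Rightarrow> bool" where
  "left_scattered T t \<longleftrightarrow> bwd_jump T t < t"

definition is_maximum :: "real set \<Rightarrow> real \<Rightarrow> bool" where
  "is_maximum T m \<longleftrightarrow> m \<in> T \<and> (\<forall>s\<in>T. s \<le> m)"

definition ts_kappa :: "real set \<Rightarrow> real set" where
  "ts_kappa T = T - {m. is_maximum T m \<and> left_scattered T m}"

text \<open>
  A relation, because at the only point of a singleton time scale (and at a left-scattered
  maximum, which is not in \<open>ts_kappa T\<close>) every number is a derivative. At all other points the
  derivative is unique.
\<close>

definition has_delta_deriv :: "real set \<Rightarrow> (real \<Rightarrow> complex) \<Rightarrow> complex \<Rightarrow> real \<Rightarrow> bool" where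
  "has_delta_deriv T f D t \<longleftrightarrow>
     (\<forall>\<epsilon>>0. \<exists>\<delta>>0. \<forall>s\<in>{t - \<delta><..<t + \<delta>} \<inter> T.
        cmod ((f (fwd_jump T t) - f s) - D * of_real (fwd_jump T t - s))
          \<le> \<epsilon> * \<bar>fwd_jump T t - s\<bar>)"

definition rd_continuous :: "real set \<Rightarrow> (real \<Rightarrow> 'a::topological_space) \<Rightarrow> bool" where
  "rd_continuous T f \<longleftrightarrow>
     (\<forall>t\<in>T. right_dense T t \<longrightarrow> (f \<longlongrightarrow> f t) (at t within T)) \<and>
     (\<forall>t\<in>T. left_dense T t \<longrightarrow> (\<exists>l. (f \<longlongrightarrow> l) (at t within T \<inter> {..<t})))"

definition rd_continuous2 :: "real set \<Rightarrow> (real \<Rightarrow> real \<Rightarrow> real) \<Rightarrow> bool" where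
  "rd_continuous2 T k \<longleftrightarrow>
     (\<forall>\<alpha>\<in>{0..1}. rd_continuous T (k \<alpha>)) \<and>
     (\<forall>t\<in>T. continuous_on {0..1} (\<lambda>\<alpha>. k \<alpha> t))"

definition admissible_pair ::
    "real set \<Rightarrow> (real \<Rightarrow> real \<Rightarrow> real) \<Rightarrow> (real \<Rightarrow> real \<Rightarrow> real) \<Rightarrow> bool" where
  "admissible_pair T k0 k1 \<longleftrightarrow>
     rd_continuous2 T k0 \<and> rd_continuous2 T k1 \<and>
     (\<forall>\<alpha>\<in>{0..1}. \<forall>t\<in>T. 0 \<le> k0 \<alpha> t \<and> 0 \<le> k1 \<alpha> t) \<and>
     (\<forall>t\<in>T.
        ((\<lambda>\<alpha>. k1 \<alpha> t) \<longlongrightarrow> 1) (at_right 0) \<and> ((\<lambda>\<alpha>. k0 \<alpha> t) \<longlongrightarrow> 0) (at_right 0) \<and>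
        ((\<lambda>\<alpha>. k1 \<alpha> t) \<longlongrightarrow> 0) (at_left 1) \<and> ((\<lambda>\<alpha>. k0 \<alpha> t) \<longlongrightarrow> 1) (at_left 1) \<and>
        (\<forall>\<alpha>\<in>{0..<1}. k1 \<alpha> t \<noteq> 0) \<and> (\<forall>\<alpha>\<in>{0<..1}. k0 \<alpha> t \<noteq> 0))"

text \<open>
  The delta integral is the Cauchy integral: the increment of an antiderivative. Antiderivatives
  are unique up to a constant, and \<open>a\<close> and \<open>b\<close> may come in either order.
\<close>

definition has_delta_integral ::
    "real set \<Rightarrow> (real \<Rightarrow> complex) \<Rightarrow> complex \<Rightarrow> real \<Rightarrow> real \<Rightarrow> bool" where
  "has_delta_integral T f I a b \<longleftrightarrow>
     (\<exists>F. (\<forall>t\<in>ts_kappa T. has_delta_deriv T F (f t) t) \<and> I = F b - F a)"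

definition delta_integral :: "real set \<Rightarrow> (real \<Rightarrow> complex) \<Rightarrow> real \<Rightarrow> real \<Rightarrow> complex" where
  "delta_integral T f a b = (THE I. has_delta_integral T f I a b)"

definition cylinder :: "real \<Rightarrow> complex \<Rightarrow> complex" where
  "cylinder h z = (if h = 0 then z else Ln (1 + of_real h * z) / of_real h)"

definition delta_exp :: "real set \<Rightarrow> (real \<Rightarrow> complex) \<Rightarrow> real \<Rightarrow> real \<Rightarrow> complex" where
  "delta_exp T q t s = exp (delta_integral T (\<lambda>\<tau>. cylinder (graininess T \<tau>) (q \<tau>)) s t)"

definition conf_exponent ::
    "(real \<Rightarrow> real \<Rightarrow> real) \<Rightarrow> (real \<Rightarrow> real \<Rightarrow> real) \<Rightarrow> real \<Rightarrow> (real \<Rightarrow> complex) \<Rightarrow> real \<Rightarrow> complex"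
  where
  "conf_exponent k0 k1 \<alpha> r t = (r t - of_real (k1 \<alpha> t)) / of_real (k0 \<alpha> t)"

definition conf_exp ::
    "real set \<Rightarrow> (real \<Rightarrow> real \<Rightarrow> real) \<Rightarrow> (real \<Rightarrow> real \<Rightarrow> real) \<Rightarrow> real \<Rightarrow> (real \<Rightarrow> complex)
      \<Rightarrow> real \<Rightarrow> real \<Rightarrow> complex" where
  "conf_exp T k0 k1 \<alpha> r t s = delta_exp T (conf_exponent k0 k1 \<alpha> r) t s"

definition conf_cos ::
    "real set \<Rightarrow> (real \<Rightarrow> real \<Rightarrow> real) \<Rightarrow> (real \<Rightarrow> real \<Rightarrow> real) \<Rightarrow> real \<Rightarrow> real
      \<Rightarrow> real \<Rightarrow> real \<Rightarrow> complex" where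
  "conf_cos T k0 k1 \<alpha> \<gamma> t t0 =
     (conf_exp T k0 k1 \<alpha> (\<lambda>_. \<i> * of_real \<gamma>) t t0
      + conf_exp T k0 k1 \<alpha> (\<lambda>_. - (\<i> * of_real \<gamma>)) t t0) / 2"

definition conf_sin ::
    "real set \<Rightarrow> (real \<Rightarrow> real \<Rightarrow> real) \<Rightarrow> (real \<Rightarrow> real \<Rightarrow> real) \<Rightarrow> real \<Rightarrow> real
      \<Rightarrow> real \<Rightarrow> real \<Rightarrow> complex" where
  "conf_sin T k0 k1 \<alpha> \<gamma> t t0 =
     (conf_exp T k0 k1 \<alpha> (\<lambda>_. \<i> * of_real \<gamma>) t t0
      - conf_exp T k0 k1 \<alpha> (\<lambda>_. - (\<i> * of_real \<gamma>)) t t0) / (2 * \<i>)"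

definition has_conf_deriv ::
    "real set \<Rightarrow> (real \<Rightarrow> real \<Rightarrow> real) \<Rightarrow> (real \<Rightarrow> real \<Rightarrow> real) \<Rightarrow> real \<Rightarrow> (real \<Rightarrow> complex)
      \<Rightarrow> complex \<Rightarrow> real \<Rightarrow> bool" where
  "has_conf_deriv T k0 k1 \<alpha> f D t \<longleftrightarrow>
     (\<exists>f'. has_delta_deriv T f f' t \<and> D = of_real (k1 \<alpha> t) * f t + of_real (k0 \<alpha> t) * f')"

text \<open>
  Both derivatives are taken with respect to \<open>T\<close>. If \<open>T\<close> has a left-scattered maximum \<open>m\<close> then
  the first derivative \<open>u\<close> is determined on \<open>T - {m}\<close> only. The value \<open>u m\<close> enters the second
  derivative solely when the predecessor of \<open>m\<close> belongs to \<open>ts_kappa (ts_kappa T)\<close>, that is, when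
  it is left-dense or the minimum of \<open>T\<close>; there \<open>u m\<close> is an unconstrained value.
\<close>

definition solves_conf_oscillator ::
    "real set \<Rightarrow> (real \<Rightarrow> real \<Rightarrow> real) \<Rightarrow> (real \<Rightarrow> real \<Rightarrow> real) \<Rightarrow> real \<Rightarrow> real
      \<Rightarrow> (real \<Rightarrow> complex) \<Rightarrow> bool" where
  "solves_conf_oscillator T k0 k1 \<alpha> \<gamma> y \<longleftrightarrow>
     (\<exists>u. (\<forall>t\<in>ts_kappa T. has_conf_deriv T k0 k1 \<alpha> y (u t) t) \<and>
          (\<forall>t\<in>ts_kappa (ts_kappa T).
             \<exists>v. has_conf_deriv T k0 k1 \<alpha> u v t \<and> v + (of_real \<gamma>)\<^sup>2 * y t = 0))"

text \<open>
  The regularity under which \<open>delta_exp T q\<close> is defined: \<open>q\<close> is rd-continuous, and moreover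
  continuous at a maximum of \<open>T\<close>. The latter is not part of rd-continuity (a left-dense maximum is
  not right-dense), but an antiderivative on \<open>ts_kappa T\<close> requires it. It is vacuous at a
  left-scattered maximum. Rd-continuity of \<open>k0\<close> and \<open>k1\<close> does not imply rd-continuity of
  \<open>conf_exponent\<close>, since \<open>k0\<close> may have left limit \<open>0\<close> at a left-dense right-scattered point.
\<close>

definition exponent_regular :: "real set \<Rightarrow> (real \<Rightarrow> complex) \<Rightarrow> bool" where
  "exponent_regular T q \<longleftrightarrow>
     rd_continuous T q \<and> (\<forall>m. is_maximum T m \<longrightarrow> (q \<longlongrightarrow> q m) (at m within T))"

end

theory Submission
  imports Defs
begin

text \<open>
  Write \<open>\<Delta>\<^sup>\<alpha> f = k1 f + k0 f\<^sup>\<Delta>\<close> and \<open>c = \<i> \<gamma>\<close>. The oscillator operator factors as \<open>(\<Delta>\<^sup>\<alpha> - c)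
  (\<Delta>\<^sup>\<alpha> + c)\<close>. So if \<open>y\<close> is a solution and \<open>u = \<Delta>\<^sup>\<alpha> y\<close>, then \<open>u + c y\<close> and \<open>u - c y\<close> are
  eigenfunctions of \<open>\<Delta>\<^sup>\<alpha>\<close> with eigenvalues \<open>c\<close> and \<open>- c\<close>. As \<open>k0\<close> does not vanish, the
  eigenvalue equation for \<open>r\<close> is the linear dynamic equation \<open>w\<^sup>\<Delta> = q w\<close> with \<open>q = (r - k1) /
  k0\<close>, and its solutions are the multiples of the conformable exponential for \<open>r\<close>. Hence \<open>y\<close> is
  a combination of the exponentials for \<open>c\<close> and \<open>- c\<close>, equivalently of cosine and sine
  (\<open>eigenfunctions_proportional\<close>, \<open>solves_conf_oscillator_iff\<close>).

  That the exponential solves its equation presupposes an antiderivative of the cylinder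
  transform of \<open>q\<close>, since the delta integral is an increment of one. It is obtained by
  integrating the extension of an rd-continuous function from \<open>T\<close> to the line that is constant
  on gaps; this extension is regulated, hence integrable (\<open>delta_antiderivative_exists\<close>).
  Exponentiation then works because the cylinder transform turns the increment across a gap
  into the factor \<open>1 + \<mu> q\<close>, nonzero by \<open>conf_exponent_regressive\<close>.

  Uniqueness, both of delta integrals and of solutions, rests on one mean value argument: a
  function whose delta derivative vanishes on \<open>[a, b)\<close> has equal values at \<open>a\<close> and \<open>b\<close>,
  provided that it is continuous at \<open>b\<close> if \<open>b\<close> is left-dense (\<open>has_delta_deriv_zero_imp_eq\<close>).
  It is applied to the difference of two antiderivatives and to the quotient of two solutions.
  The half-open form is what fits the oscillator: its second derivative is controlled on
  \<open>ts_kappa (ts_kappa T)\<close> only, which may lack the right end of the interval. If \<open>T\<close> has a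
  left-scattered maximum, the representation of \<open>y\<close> is first proved on the rest of \<open>T\<close> and then
  carried to the maximum by the first-order equation at its predecessor.

  For real solutions, the exponentials for \<open>c\<close> and \<open>- c\<close> are conjugate (\<open>conf_exp_cnj\<close>), so
  cosine and sine are real and the coefficients may be replaced by their real parts.
  Conjugation is compatible with the principal logarithm here because \<open>1 + \<mu> q\<close> is 1 or
  non-real, and thus stays off the branch cut.
\<close>

section \<open>Jump operators and dense points\<close>

lemma fwd_jump_ge: "t \<in> T \<Longrightarrow> t \<le> fwd_jump T t"
  unfolding fwd_jump_def
  by (auto intro!: cInf_greatest) (metis (mono_tags, lifting) antisym_conv1 linorder_not_less order_refl cSup_eq_maximum)

lemma fwd_jump_le: "s \<in> T \<Longrightarrow> t < s \<Longrightarrow> fwd_jump T t \<le> s"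
  unfolding fwd_jump_def by (auto intro!: cInf_lower bdd_belowI[of _ t])

lemma fwd_jump_maximum:
  assumes "t \<in> T" "\<forall>s\<in>T. s \<le> t"
  shows "fwd_jump T t = t"
  using assms unfolding fwd_jump_def
  by (metis cSup_eq_maximum linorder_not_less)

lemma fwd_jump_in:
  assumes "closed T" "t \<in> T"
  shows "fwd_jump T t \<in> T"
proof (cases "\<exists>s\<in>T. t < s")
  case True
  then have "Inf {s\<in>T. t < s} \<in> closure {s\<in>T. t < s}"
    by (intro closure_contains_Inf) (auto intro!: bdd_belowI[of _ t])
  also have "\<dots> \<subseteq> T"
    using assms by (intro closure_minimal) auto
  finally show ?thesis
    using True by (simp add: fwd_jump_def)
next
  case False
  then show ?thesis
    using assms fwd_jump_maximum[of t T] by (simp add: not_less)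
qed

lemma right_dense_iff:
  "right_dense T t \<longleftrightarrow> (\<forall>d>0. \<exists>s\<in>T. t < s \<and> s < t + d)"
proof
  assume r: "right_dense T t"
  show "\<forall>d>0. \<exists>s\<in>T. t < s \<and> s < t + d"
  proof (intro allI impI)
    fix d :: real
    assume "d > 0"
    have "Inf {s\<in>T. t < s} < t + d"
      using r \<open>d > 0\<close> by (auto simp: right_dense_def fwd_jump_def split: if_splits)
    then show "\<exists>s\<in>T. t < s \<and> s < t + d"
      using r by (subst (asm) cInf_less_iff) (auto simp: right_dense_def intro!: bdd_belowI[of _ t])
  qed
next
  assume d: "\<forall>d>0. \<exists>s\<in>T. t < s \<and> s < t + d"
  then have ex: "\<exists>s\<in>T. t < s"
    by (metis zero_less_one)
  have "Inf {s\<in>T. t < s} = t"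
  proof (rule antisym)
    show "t \<le> Inf {s\<in>T. t < s}"
      using ex by (intro cInf_greatest) auto
    show "Inf {s\<in>T. t < s} \<le> t"
    proof (rule field_le_epsilon)
      fix e :: real
      assume "e > 0"
      then obtain s where "s \<in> T" "t < s" "s < t + e"
        using d by blast
      then show "Inf {s\<in>T. t < s} \<le> t + e"
        by (intro cInf_lower2[of s]) (auto intro!: bdd_belowI[of _ t])
    qed
  qed
  then show "right_dense T t"
    using ex by (simp add: right_dense_def fwd_jump_def)
qed

lemma left_dense_iff:
  "left_dense T t \<longleftrightarrow> (\<forall>d>0. \<exists>s\<in>T. t - d < s \<and> s < t)"
proof
  assume r: "left_dense T t"
  show "\<forall>d>0. \<exists>s\<in>T. t - d < s \<and> s < t"
  proof (intro allI impI)
    fix d :: real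
    assume "d > 0"
    have "t - d < Sup {s\<in>T. s < t}"
      using r \<open>d > 0\<close> by (auto simp: left_dense_def bwd_jump_def split: if_splits)
    then show "\<exists>s\<in>T. t - d < s \<and> s < t"
      using r by (subst (asm) less_cSup_iff) (auto simp: left_dense_def intro!: bdd_aboveI[of _ t])
  qed
next
  assume d: "\<forall>d>0. \<exists>s\<in>T. t - d < s \<and> s < t"
  then have ex: "\<exists>s\<in>T. s < t"
    by (metis zero_less_one)
  have "Sup {s\<in>T. s < t} = t"
  proof (rule antisym)
    show "Sup {s\<in>T. s < t} \<le> t"
      using ex by (intro cSup_least) auto
    show "t \<le> Sup {s\<in>T. s < t}"
    proof (rule field_le_epsilon)
      fix e :: real
      assume "e > 0"
      then obtain s where "s \<in> T" "t - e < s" "s < t"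
        using d by blast
      moreover from this have "s \<le> Sup {s\<in>T. s < t}"
        by (intro cSup_upper) (auto intro!: bdd_aboveI[of _ t])
      ultimately show "t \<le> Sup {s\<in>T. s < t} + e"
        by simp
    qed
  qed
  then show "left_dense T t"
    using ex by (simp add: left_dense_def bwd_jump_def)
qed

lemma ts_kappa_subset: "ts_kappa T \<subseteq> T"
  by (auto simp: ts_kappa_def)

lemma ts_kappa_not_last: "t \<in> T \<Longrightarrow> s \<in> T \<Longrightarrow> t < s \<Longrightarrow> t \<in> ts_kappa T"
  by (auto simp: ts_kappa_def is_maximum_def not_le)

lemma ts_kappa_left_dense: "t \<in> T \<Longrightarrow> left_dense T t \<Longrightarrow> t \<in> ts_kappa T"
  by (auto simp: ts_kappa_def left_scattered_def left_dense_def)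

lemma maximum_outside_ts_kappa: "m \<in> T \<Longrightarrow> m \<notin> ts_kappa T \<Longrightarrow> is_maximum T m \<and> left_scattered T m"
  by (auto simp: ts_kappa_def)

section \<open>The delta derivative\<close>

text \<open>
  The delta derivative mixes two notions, according to whether \<open>\<sigma>(t) = t\<close> or \<open>t < \<sigma>(t)\<close>: it is
  the ordinary derivative within \<open>T\<close> in the former case, and continuity together with a
  difference quotient over the gap in the latter. Separating the two reduces every calculus
  rule below to its classical counterpart and a computation at the jump.
\<close>

lemma has_delta_deriv_dense:
  assumes "t \<in> T" "fwd_jump T t = t"
  shows "has_delta_deriv T f D t \<longleftrightarrow> (f has_vector_derivative D) (at t within T)"
proof -
  have "norm (f t - f s - D * of_real (t - s)) = norm (f s - f t - (s - t) *\<^sub>R D)" for s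
    by (subst norm_minus_cancel[symmetric]) (simp add: scaleR_conv_of_real algebra_simps)
  then show ?thesis
    unfolding has_delta_deriv_def has_vector_derivative_def has_derivative_within_alt assms(2)
    by (auto simp: bounded_linear_scaleR_left abs_minus_commute dist_real_def abs_less_iff
        Ball_def Bex_def) 
      (smt (verit))+
qed

text \<open>
  As \<open>s\<close> tends to \<open>t\<close>, the error bound \<open>\<epsilon> * (\<sigma>(t) - s)\<close> does not shrink below \<open>\<epsilon> * \<mu>(t)\<close>. Hence
  \<open>s = t\<close> pins down the quotient exactly, and nearby \<open>s\<close> contribute no more than continuity.
\<close>

lemma has_delta_deriv_scattered:
  assumes "t \<in> T" "t < fwd_jump T t"
  shows "has_delta_deriv T f D t \<longleftrightarrow>
    (f \<longlongrightarrow> f t) (at t within T) \<and> f (fwd_jump T t) - f t = D * of_real (graininess T t)"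
    (is "_ \<longleftrightarrow> ?c \<and> ?j")
proof
  let ?m = "graininess T t"
  have m: "?m > 0" "fwd_jump T t = t + ?m"
    using assms by (auto simp: graininess_def)
  {
    assume D: "has_delta_deriv T f D t"
    have small: "cmod (f (t + ?m) - f t - D * of_real ?m) \<le> \<epsilon> * ?m" if "\<epsilon> > 0" for \<epsilon>
    proof -
      note \<epsilon> = that
      obtain d where "d > 0" "\<forall>s\<in>{t - d<..<t + d} \<inter> T.
          cmod ((f (t + ?m) - f s) - D * of_real (t + ?m - s)) \<le> \<epsilon> * \<bar>t + ?m - s\<bar>"
        using D \<epsilon> unfolding has_delta_deriv_def m(2) by blast
      from this(2)[rule_format, of t] this(1) show ?thesis
        using assms m by simp
    qed
    have "cmod (f (t + ?m) - f t - D * of_real ?m) \<le> 0"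
    proof (rule field_le_epsilon)
      fix e :: real
      assume "e > 0"
      then show "cmod (f (t + ?m) - f t - D * of_real ?m) \<le> 0 + e"
        using small[of "e / ?m"] m by simp
    qed
    then have j: ?j
      by (simp add: m(2))
    have ?c
      unfolding Lim_within
    proof (intro allI impI)
      fix e :: real
      assume "e > 0"
      \<comment> \<open>for \<open>s\<close> within \<open>\<mu>\<close> of \<open>t\<close> the distance to \<open>\<sigma>(t)\<close> is at most \<open>2 * \<mu>\<close>, so this \<open>\<epsilon>\<close> leaves an error of \<open>e / 2\<close>\<close>
      define \<epsilon> where "\<epsilon> = e / (4 * ?m)"
      have \<epsilon>: "\<epsilon> > 0"
        using \<open>e > 0\<close> m by (simp add: \<epsilon>_def)
      obtain d where d: "d > 0" "\<forall>s\<in>{t - d<..<t + d} \<inter> T.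
          cmod ((f (t + ?m) - f s) - D * of_real (t + ?m - s)) \<le> \<epsilon> * \<bar>t + ?m - s\<bar>"
        using D \<epsilon> unfolding has_delta_deriv_def m(2) by blast
      define d' where "d' = min (min d ?m) (e / (2 * (cmod D + 1)))"
      have "d' > 0"
        using d m \<open>e > 0\<close> by (auto simp: d'_def intro!: divide_pos_pos add_nonneg_pos)
      moreover have "dist (f s) (f t) < e" if s: "s \<in> T" "dist s t < d'" for s
      proof -
        have s': "\<bar>s - t\<bar> < d" "\<bar>s - t\<bar> < ?m" "\<bar>s - t\<bar> < e / (2 * (cmod D + 1))"
          using s by (auto simp: d'_def dist_real_def)
        have eq: "f t - f s = (f (t + ?m) - f s - D * of_real (t + ?m - s)) + D * of_real (t - s)"
          using j by (simp add: m(2) algebra_simps)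
        have "cmod (f (t + ?m) - f s - D * of_real (t + ?m - s)) \<le> \<epsilon> * \<bar>t + ?m - s\<bar>"
          using s(1) s'(1) by (intro d(2)[rule_format]) (auto simp: abs_less_iff)
        also have "\<dots> \<le> \<epsilon> * (2 * ?m)"
          using s' \<epsilon> by (intro mult_left_mono) auto
        also have "\<dots> = e / 2"
          using m by (simp add: \<epsilon>_def)
        finally have 1: "cmod (f (t + ?m) - f s - D * of_real (t + ?m - s)) \<le> e / 2" .
        have "cmod (D * of_real (t - s)) \<le> (cmod D + 1) * \<bar>s - t\<bar>"
          by (simp add: norm_mult abs_minus_commute mult_right_mono flip: of_real_diff)
        also have "\<dots> < (cmod D + 1) * (e / (2 * (cmod D + 1)))"
          using s' by (intro mult_strict_left_mono) (auto intro: add_nonneg_pos)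
        also have "\<dots> = e / 2"
          using norm_ge_zero[of D] by (simp add: field_simps add_nonneg_eq_0_iff)
        finally have "cmod (D * of_real (t - s)) < e / 2" .
        with 1 have "cmod (f t - f s) < e"
          unfolding eq using norm_triangle_ineq by (smt (verit) field_sum_of_halves)
        then show ?thesis
          by (simp add: dist_norm norm_minus_commute)
      qed
      ultimately show "\<exists>d>0. \<forall>x\<in>T. 0 < dist x t \<and> dist x t < d \<longrightarrow> dist (f x) (f t) < e"
        by blast
    qed
    with j show "?c \<and> ?j" by simp
  }
  {
    assume "?c \<and> ?j"
    then have c: ?c and j: ?j by auto
    have lim: "((\<lambda>s. (f t - f s) - D * of_real (t - s)) \<longlongrightarrow> (f t - f t) - D * of_real (t - t)) (at t within T)"
      by (intro tendsto_intros c)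
    show "has_delta_deriv T f D t"
      unfolding has_delta_deriv_def
    proof (intro allI impI)
      fix \<epsilon> :: real
      assume "\<epsilon> > 0"
      then have "\<epsilon> * (?m / 2) > 0"
        using m by simp
      with lim obtain d where d0: "d > 0" "\<And>s. s \<in> T \<Longrightarrow> 0 < dist s t \<Longrightarrow> dist s t < d \<Longrightarrow>
          dist ((f t - f s) - D * of_real (t - s)) ((f t - f t) - D * of_real (t - t)) < \<epsilon> * (?m / 2)"
        unfolding Lim_within by meson
      then have d: "d > 0" "\<And>s. s \<in> T \<Longrightarrow> 0 < dist s t \<Longrightarrow> dist s t < d \<Longrightarrow>
          cmod ((f t - f s) - D * of_real (t - s)) < \<epsilon> * (?m / 2)"
        by (simp_all add: dist_norm)
      show "\<exists>\<delta>>0. \<forall>s\<in>{t - \<delta><..<t + \<delta>} \<inter> T.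
        cmod ((f (fwd_jump T t) - f s) - D * of_real (fwd_jump T t - s))
          \<le> \<epsilon> * \<bar>fwd_jump T t - s\<bar>"
      proof (intro exI conjI ballI)
        \<comment> \<open>within \<open>\<mu> / 2\<close> of \<open>t\<close> the admissible error is at least \<open>\<epsilon> * \<mu> / 2\<close>, which continuity can meet\<close>
        show "min d (?m / 2) > 0"
          using d m by simp
        fix s
        assume "s \<in> {t - min d (?m / 2)<..<t + min d (?m / 2)} \<inter> T"
        then have s: "s \<in> T" "\<bar>s - t\<bar> < d" "\<bar>s - t\<bar> < ?m / 2"
          unfolding abs_less_iff by auto
        have eq: "(f (fwd_jump T t) - f s) - D * of_real (fwd_jump T t - s)
            = (f t - f s) - D * of_real (t - s)"
          using j by (simp add: m(2) algebra_simps)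
        have "cmod ((f t - f s) - D * of_real (t - s)) \<le> \<epsilon> * (?m / 2)"
          using d(2)[of s] s \<open>\<epsilon> * (?m / 2) > 0\<close> by (cases "s = t") (auto simp: dist_real_def)
        also have "\<dots> \<le> \<epsilon> * \<bar>fwd_jump T t - s\<bar>"
          using s(3) m \<open>\<epsilon> > 0\<close> by (intro mult_left_mono; linarith)
        finally show "cmod ((f (fwd_jump T t) - f s) - D * of_real (fwd_jump T t - s))
          \<le> \<epsilon> * \<bar>fwd_jump T t - s\<bar>"
          unfolding eq .
      qed
    qed
  }
qed

lemma has_delta_deriv_continuous:
  assumes "t \<in> T" "has_delta_deriv T f D t"
  shows "(f \<longlongrightarrow> f t) (at t within T)"
proof (cases "fwd_jump T t = t")
  case True
  then show ?thesis
    using assms has_delta_deriv_dense[of t T f D] has_vector_derivative_continuous[of f D t T]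
    by (simp add: continuous_within)
next
  case False
  then show ?thesis
    using assms has_delta_deriv_scattered[of t T f D] fwd_jump_ge[of t T] by simp
qed

lemma has_delta_deriv_jump:
  assumes "t \<in> T" "has_delta_deriv T f D t"
  shows "f (fwd_jump T t) = f t + D * of_real (graininess T t)"
proof (cases "fwd_jump T t = t")
  case False
  then show ?thesis
    using assms has_delta_deriv_scattered[of t T f D] fwd_jump_ge[of t T]
    by (auto simp: less_le algebra_simps)
qed (simp add: graininess_def)

section \<open>Functions with vanishing delta derivative\<close>

text \<open>
  An increment bound \<open>\<epsilon> * (s - a)\<close> propagates along \<open>T\<close>: its supremum of validity is reached by
  continuity from the left, and it can be passed by the derivative, either to nearby points on
  the right or across the gap, where \<open>F\<close> does not change. The right end point \<open>b\<close> is reached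
  but never left, so only continuity enters there. This matters for a maximum, where a
  derivative may be unavailable.
\<close>

lemma has_delta_deriv_zero_imp_eq:
  assumes T: "closed T" "a \<in> T" "b \<in> T" "a \<le> b"
    and der: "\<And>t. t \<in> T \<Longrightarrow> a \<le> t \<Longrightarrow> t < b \<Longrightarrow> has_delta_deriv T F 0 t"
    and cont: "left_dense T b \<Longrightarrow> (F \<longlongrightarrow> F b) (at b within T)"
  shows "F a = F b"
proof -
  have main: "cmod (F b - F a) \<le> \<epsilon> * (b - a)" if "\<epsilon> > 0" for \<epsilon>
  proof -
    define good where "good s \<longleftrightarrow> cmod (F s - F a) \<le> \<epsilon> * (s - a)" for s
    define S where "S = {t\<in>T. a \<le> t \<and> t \<le> b \<and> (\<forall>s\<in>T. a \<le> s \<longrightarrow> s \<le> t \<longrightarrow> good s)}"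
    have "a \<in> S"
      using T by (auto simp: S_def good_def)
    have bdd: "bdd_above S"
      by (auto simp: S_def intro!: bdd_aboveI[of _ b])
    define c where "c = Sup S"
    have c: "a \<le> c" "c \<le> b"
      using \<open>a \<in> S\<close> bdd unfolding c_def
      by (auto intro!: cSup_upper cSup_least simp: S_def)
    have "c \<in> closure S"
      unfolding c_def using \<open>a \<in> S\<close> bdd by (intro closure_contains_Sup) auto
    also have "\<dots> \<subseteq> T"
      using T by (intro closure_minimal) (auto simp: S_def)
    finally have "c \<in> T" .
    have below: "good s" if "s \<in> T" "a \<le> s" "s < c" for s
    proof -
      have "s < Sup S"
        using that by (simp add: c_def)
      then obtain t where "t \<in> S" "s < t"
        using \<open>a \<in> S\<close> bdd by (subst (asm) less_cSup_iff) auto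
      then show ?thesis
        using that by (auto simp: S_def)
    qed
    have "c \<in> S"
    proof (rule ccontr)
      assume "c \<notin> S"
      have near: "\<exists>s\<in>S. c - d < s \<and> s < c" if "d > 0" for d
      proof -
        have "c - d < Sup S"
          using that by (simp add: c_def)
        then obtain s where "s \<in> S" "c - d < s"
          using \<open>a \<in> S\<close> bdd by (subst (asm) less_cSup_iff) auto
        moreover from this have "s \<le> c"
          unfolding c_def using bdd by (intro cSup_upper)
        ultimately show ?thesis
          using \<open>c \<notin> S\<close> by (metis less_le)
      qed
      then have "left_dense T c"
        unfolding left_dense_iff by (auto simp: S_def)
      then have cc: "(F \<longlongrightarrow> F c) (at c within T)"
        using cont der[of c] c has_delta_deriv_continuous[OF \<open>c \<in> T\<close>, of F 0] \<open>c \<in> T\<close>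
        by (cases "c = b") auto
      have "good c"
      proof (rule ccontr)
        assume "\<not> good c"
        then have "cmod (F c - F a) - \<epsilon> * (c - a) > 0"
          by (simp add: good_def)
        with cc obtain d where d: "d > 0" "\<And>s. s \<in> T \<Longrightarrow> 0 < dist s c \<Longrightarrow> dist s c < d \<Longrightarrow>
            dist (F s) (F c) < cmod (F c - F a) - \<epsilon> * (c - a)"
          unfolding Lim_within by meson
        from near[OF d(1)] obtain s where s: "s \<in> S" "c - d < s" "s < c" by blast
        have "cmod (F s - F c) < cmod (F c - F a) - \<epsilon> * (c - a)"
          using d(2)[of s] s by (auto simp: S_def dist_real_def dist_norm)
        moreover have "cmod (F s - F a) \<le> \<epsilon> * (s - a)"
          using s by (auto simp: S_def good_def)
        moreover have "\<epsilon> * (s - a) \<le> \<epsilon> * (c - a)"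
          using s \<open>\<epsilon> > 0\<close> by simp
        moreover have "cmod (F c - F a) \<le> cmod (F s - F c) + cmod (F s - F a)"
          by (metis norm_minus_commute norm_triangle_sub norm_triangle_ineq diff_add_cancel add_diff_eq)
        ultimately show False by linarith
      qed
      then have "c \<in> S"
        using below \<open>c \<in> T\<close> c by (auto simp: S_def less_le)
      with \<open>c \<notin> S\<close> show False ..
    qed
    have "c = b"
    proof (rule ccontr)
      assume "c \<noteq> b"
      then have "c < b" using c by simp
      then have D: "has_delta_deriv T F 0 c"
        using der \<open>c \<in> T\<close> c by auto
      have "good c" using \<open>c \<in> S\<close> \<open>c \<in> T\<close> by (auto simp: S_def)
      have "\<exists>t\<in>T. c < t \<and> t \<le> b \<and> (\<forall>s\<in>T. c < s \<longrightarrow> s \<le> t \<longrightarrow> cmod (F s - F c) \<le> \<epsilon> * (s - c))"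
      proof (cases "fwd_jump T c = c")
        case True
        obtain d where d: "d > 0" "\<forall>s\<in>{c - d<..<c + d} \<inter> T.
            cmod ((F c - F s) - 0 * of_real (c - s)) \<le> \<epsilon> * \<bar>c - s\<bar>"
          using D \<open>\<epsilon> > 0\<close> unfolding has_delta_deriv_def True by blast
        have "right_dense T c"
          using True \<open>c < b\<close> T by (auto simp: right_dense_def)
        then obtain t where t: "t \<in> T" "c < t" "t < c + min d (b - c)"
          unfolding right_dense_iff using \<open>d > 0\<close> \<open>c < b\<close> by (meson diff_gt_0_iff_gt min_less_iff_conj)
        then have "t < c + d" "t \<le> b"
          by auto
        have "cmod (F s - F c) \<le> \<epsilon> * (s - c)" if "s \<in> T" "c < s" "s \<le> t" for s
          using d(2)[rule_format, of s] that \<open>t < c + d\<close> by (auto simp: norm_minus_commute)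
        with t \<open>t \<le> b\<close> show ?thesis by (intro bexI[of _ t]) auto
      next
        case False
        then have "c < fwd_jump T c"
          using fwd_jump_ge[OF \<open>c \<in> T\<close>] by simp
        moreover have "s = fwd_jump T c" if "s \<in> T" "c < s" "s \<le> fwd_jump T c" for s
          using fwd_jump_le[of s T c] that by simp
        ultimately show ?thesis
          using has_delta_deriv_jump[OF \<open>c \<in> T\<close> D] fwd_jump_in[OF T(1) \<open>c \<in> T\<close>] \<open>\<epsilon> > 0\<close>
            fwd_jump_le[of b T c] \<open>c < b\<close> T
          by (intro bexI[of _ "fwd_jump T c"]) fastforce+
      qed
      then obtain t where t: "t \<in> T" "c < t" "t \<le> b"
        and "\<forall>s\<in>T. c < s \<longrightarrow> s \<le> t \<longrightarrow> cmod (F s - F c) \<le> \<epsilon> * (s - c)" by blast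
      then have "good s" if "s \<in> T" "c < s" "s \<le> t" for s
        using \<open>good c\<close> that norm_triangle_ineq[of "F s - F c" "F c - F a"]
        unfolding good_def by (fastforce simp: algebra_simps)
      then have "t \<in> S"
        using t c \<open>c \<in> S\<close> by (auto simp: S_def)
      then have "t \<le> c"
        unfolding c_def using bdd by (intro cSup_upper)
      with t show False by simp
    qed
    with \<open>c \<in> S\<close> T show ?thesis
      by (auto simp: S_def good_def)
  qed
  have "cmod (F b - F a) \<le> 0"
  proof (cases "a = b")
    case False
    show ?thesis
    proof (rule field_le_epsilon)
      fix e :: real
      assume "e > 0"
      then show "cmod (F b - F a) \<le> 0 + e"
        using main[of "e / (b - a)"] T False by simp
    qed
  qed simp
  then show ?thesis by simp
qed

section \<open>Antiderivatives of rd-continuous functions\<close>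

text \<open>
  Composing with \<open>floor_point T\<close> extends a function from \<open>T\<close> to the line by keeping it
  constant, with the value at the left end, on every gap.
\<close>

definition floor_point :: "real set \<Rightarrow> real \<Rightarrow> real" where
  "floor_point T x = Sup {\<tau>\<in>T. \<tau> \<le> x}"

lemma floor_point_ge: "s \<in> T \<Longrightarrow> s \<le> x \<Longrightarrow> s \<le> floor_point T x"
  unfolding floor_point_def by (intro cSup_upper) (auto intro!: bdd_aboveI[of _ x])

lemma floor_point_in_le:
  assumes "closed T" "a \<in> T" "a \<le> x"
  shows "floor_point T x \<in> T" "floor_point T x \<le> x"
proof -
  have "floor_point T x \<in> closure {\<tau>\<in>T. \<tau> \<le> x}"
    unfolding floor_point_def using assms
    by (intro closure_contains_Sup) (auto intro!: bdd_aboveI[of _ x])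
  also have "\<dots> \<subseteq> T"
    using assms by (intro closure_minimal) auto
  finally show "floor_point T x \<in> T" .
  show "floor_point T x \<le> x"
    unfolding floor_point_def using assms by (intro cSup_least) auto
qed

lemma floor_point_gap:
  assumes "x \<le> z" "\<And>s. s \<in> T \<Longrightarrow> x < s \<Longrightarrow> s \<le> z \<Longrightarrow> False"
  shows "floor_point T z = floor_point T x"
proof -
  have "{\<tau>\<in>T. \<tau> \<le> z} = {\<tau>\<in>T. \<tau> \<le> x}"
    using assms by force
  then show ?thesis by (simp add: floor_point_def)
qed

text \<open>
  The step extension of an rd-continuous function is regulated: each real number is either
  approached by points of \<open>T\<close> from the side in question, so that it is a right-dense
  (left-dense) point of \<open>T\<close> and rd-continuity provides the limit, or it borders on a gap, where
  the extension is constant.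
\<close>

lemma rd_continuous_right_limit:
  assumes T: "closed T" "a \<in> T" "a \<le> x" and g: "rd_continuous T g" and "e > 0"
  obtains L :: complex and d where "d > 0"
    "\<And>z. x < z \<Longrightarrow> z < x + d \<Longrightarrow> norm (g (floor_point T z) - L) \<le> e"
proof (cases "\<exists>d>0. \<forall>s\<in>T. x < s \<longrightarrow> x + d \<le> s")
  case True
  then obtain d where d: "d > 0" "\<forall>s\<in>T. x < s \<longrightarrow> x + d \<le> s" by blast
  have "norm (g (floor_point T z) - g (floor_point T x)) \<le> e" if "x < z" "z < x + d" for z
    using floor_point_gap[of x z T] d that \<open>e > 0\<close> by force
  with d(1) show ?thesis by (rule that)
next
  case False
  then have near: "\<forall>d>0. \<exists>s\<in>T. x < s \<and> s < x + d"
    by (meson not_le)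
  then have "\<forall>d>0. \<exists>s\<in>T. dist s x < d"
    by (force simp: dist_real_def)
  then have "x \<in> T"
    using T(1) closure_approachable closure_closed by metis
  moreover have "right_dense T x"
    using near by (simp add: right_dense_iff)
  ultimately have "(g \<longlongrightarrow> g x) (at x within T)"
    using g by (auto simp: rd_continuous_def)
  then obtain d where d: "d > 0" "\<And>s. s \<in> T \<Longrightarrow> 0 < dist s x \<Longrightarrow> dist s x < d \<Longrightarrow> dist (g s) (g x) < e"
    using \<open>e > 0\<close> unfolding Lim_within by meson
  have "norm (g (floor_point T z) - g x) \<le> e" if z: "x < z" "z < x + d" for z
  proof -
    have "floor_point T z \<in> T" "floor_point T z \<le> z" "x \<le> floor_point T z"
      using floor_point_in_le[of T x z] floor_point_ge[of x T z] T \<open>x \<in> T\<close> z by auto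
    then show ?thesis
      using d(2)[of "floor_point T z"] z \<open>e > 0\<close>
      by (cases "floor_point T z = x") (auto simp: dist_norm)
  qed
  with d(1) show ?thesis by (rule that)
qed

lemma rd_continuous_left_limit:
  assumes T: "closed T" and g: "rd_continuous T g" and "e > 0"
  obtains L :: complex and d where "d > 0"
    "\<And>z. x - d < z \<Longrightarrow> z < x \<Longrightarrow> norm (g (floor_point T z) - L) \<le> e"
proof (cases "\<exists>d>0. \<forall>s\<in>T. s < x \<longrightarrow> s \<le> x - d")
  case True
  then obtain d where d: "d > 0" "\<forall>s\<in>T. s < x \<longrightarrow> s \<le> x - d" by blast
  have "norm (g (floor_point T z) - g (floor_point T (x - d))) \<le> e" if "x - d < z" "z < x" for z
    using floor_point_gap[of "x - d" z T] d that \<open>e > 0\<close> by force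
  with d(1) show ?thesis by (rule that)
next
  case False
  then have near: "\<forall>d>0. \<exists>s\<in>T. x - d < s \<and> s < x"
    by (meson not_le)
  then have "\<forall>d>0. \<exists>s\<in>T. dist s x < d"
    by (force simp: dist_real_def)
  then have "x \<in> T"
    using T closure_approachable closure_closed by metis
  moreover have "left_dense T x"
    using near by (simp add: left_dense_iff)
  ultimately obtain L where "(g \<longlongrightarrow> L) (at x within T \<inter> {..<x})"
    using g by (auto simp: rd_continuous_def)
  then obtain d where d: "d > 0"
    "\<And>s. s \<in> T \<inter> {..<x} \<Longrightarrow> 0 < dist s x \<Longrightarrow> dist s x < d \<Longrightarrow> dist (g s) L < e"
    using \<open>e > 0\<close> unfolding Lim_within by meson
  obtain s where s: "s \<in> T" "x - d < s" "s < x"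
    using near d(1) by blast
  have "norm (g (floor_point T z) - L) \<le> e" if z: "x - (x - s) < z" "z < x" for z
  proof -
    have "floor_point T z \<in> T" "floor_point T z \<le> z" "s \<le> floor_point T z"
      using floor_point_in_le[of T s z] floor_point_ge[of s T z] T s z by auto
    then show ?thesis
      using d(2)[of "floor_point T z"] z s by (auto simp: dist_norm dist_real_def)
  qed
  \<comment> \<open>the radius stops at the point \<open>s\<close> of \<open>T\<close>, so that floors stay within reach of the left limit\<close>
  with s(3) show ?thesis by (intro that[of "x - s" L]) auto
qed

text \<open>
  Regulated functions are uniform limits of step functions. The step functions are found by
  bisection, since the one-sided limits provide them on all short intervals around a given
  point.
\<close>

lemma rd_continuous_integrable:
  assumes T: "closed T" "a \<in> T" "a \<le> b" and g: "rd_continuous T g"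
  shows "(\<lambda>x. g (floor_point T x) :: complex) integrable_on {a..b}"
proof -
  define G where "G x = g (floor_point T x)" for x
  have approx: "\<exists>h. (\<forall>x\<in>{a..b}. norm (G x - h x) \<le> e) \<and> h integrable_on {a..b}" if e: "e > 0" for e
  proof -
    \<comment> \<open>the guard \<open>a \<le> u\<close> keeps the bisection where floors exist\<close>
    define P where "P u v \<longleftrightarrow> (a \<le> u \<longrightarrow> (\<exists>h. (\<forall>x\<in>{u..v}. norm (G x - h x) \<le> e) \<and> h integrable_on {u..v}))" for u v
    have "P a b"
      using \<open>a \<le> b\<close>
    proof (induction rule: Bolzano)
      case (trans u v w)
      show ?case
        unfolding P_def
      proof
        assume "a \<le> u"
        then obtain h1 where h1: "\<forall>x\<in>{u..v}. norm (G x - h1 x) \<le> e" "h1 integrable_on {u..v}"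
          using trans(1) unfolding P_def by blast
        have "a \<le> v"
          using \<open>a \<le> u\<close> trans(3) by simp
        then obtain h2 where h2: "\<forall>x\<in>{v..w}. norm (G x - h2 x) \<le> e" "h2 integrable_on {v..w}"
          using trans(2) unfolding P_def by blast
        define h where "h x = (if x \<le> v then h1 x else h2 x)" for x
        have "h integrable_on {u..v}"
          by (rule integrable_eq[OF h1(2)]) (simp add: h_def)
        moreover have "h integrable_on {v..w}"
          by (rule integrable_spike_finite[OF _ _ h2(2), of "{v}"]) (auto simp: h_def)
        ultimately have "h integrable_on {u..w}"
          using Henstock_Kurzweil_Integration.integrable_combine[OF trans(3,4)] by blast
        moreover have "\<forall>x\<in>{u..w}. norm (G x - h x) \<le> e"
          using h1(1) h2(1) by (auto simp: h_def)
        ultimately show "\<exists>h. (\<forall>x\<in>{u..w}. norm (G x - h x) \<le> e) \<and> h integrable_on {u..w}"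
          by blast
      qed
    next
      case (local x)
      obtain R dr where R: "dr > 0" "\<And>z. x < z \<Longrightarrow> z < x + dr \<Longrightarrow> norm (G z - R) \<le> e"
        using rd_continuous_right_limit[OF T(1,2) local(1) g e] unfolding G_def by metis
      obtain L dl where L: "dl > 0" "\<And>z. x - dl < z \<Longrightarrow> z < x \<Longrightarrow> norm (G z - L) \<le> e"
        using rd_continuous_left_limit[OF T(1) g e] unfolding G_def by metis
      define h where "h z = (if z < x then L else if z = x then G x else R)" for z
      have "P u v" if "u \<le> x" "x \<le> v" "v - u < min dl dr" for u v
      proof -
        have "h integrable_on {u..x}"
          by (rule integrable_spike_finite[where f = "\<lambda>_. L" and S = "{x}"])
            (auto simp: h_def integrable_const_ivl)
        moreover have "h integrable_on {x..v}"
          by (rule integrable_spike_finite[where f = "\<lambda>_. R" and S = "{x}"])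
            (auto simp: h_def integrable_const_ivl)
        ultimately have "h integrable_on {u..v}"
          using Henstock_Kurzweil_Integration.integrable_combine[OF that(1,2)] by blast
        moreover have "\<forall>z\<in>{u..v}. norm (G z - h z) \<le> e"
          using that L(2) R(2) e by (auto simp: h_def)
        ultimately show ?thesis
          unfolding P_def by blast
      qed
      then show ?case
        using L(1) R(1) by (intro exI[of _ "min dl dr"]) auto
    qed
    then show ?thesis by (auto simp: P_def)
  qed
  show ?thesis
    using integrable_uniform_limit[of a b G] approx unfolding G_def by simp
qed

text \<open>
  The antiderivative is the ordinary integral of the step extension. Over a gap the integrand
  is constant, which gives the jump \<open>\<mu>(t) * g t\<close>; at a point with \<open>\<sigma>(t) = t\<close>, continuity of \<open>g\<close>
  within \<open>T\<close> controls the extension as well, because the floor of a point between \<open>s \<in> T\<close> and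
  \<open>t\<close> lies between \<open>s\<close> and \<open>t\<close>. A left-dense maximum is such a point without being right-dense,
  whence the assumption of continuity at maxima.
\<close>

lemma delta_antiderivative_exists:
  assumes T: "time_scale T" and g: "rd_continuous T g"
    and gmax: "\<And>m. is_maximum T m \<Longrightarrow> (g \<longlongrightarrow> g m) (at m within T)"
  obtains F where "\<And>t. t \<in> ts_kappa T \<Longrightarrow> has_delta_deriv T F (g t) t"
proof -
  have cl: "closed T" and "T \<noteq> {}"
    using T by (auto simp: time_scale_def)
  then obtain a where a: "a \<in> T" by blast
  define G where "G x = g (floor_point T x)" for x
  define F where "F t = (if a \<le> t then integral {a..t} G else - integral {t..a} G)" for t
  have int: "G integrable_on {s..t}" if "s \<in> T" for s t
    using rd_continuous_integrable[OF cl that _ g, of t] unfolding G_def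
    by (cases "s \<le> t") (auto simp: integrable_on_empty)
  have diff: "F t - F s = integral {s..t} G" if st: "s \<in> T" "t \<in> T" "s \<le> t" for s t
  proof -
    have c: "integral {u..v} G + integral {v..w} G = integral {u..w} G"
      if "u \<in> T" "u \<le> v" "v \<le> w" for u v w
      using that int by (intro Henstock_Kurzweil_Integration.integral_combine) auto
    consider "a \<le> s" | "s < a" "a \<le> t" | "t < a"
      by linarith
    then show ?thesis
    proof cases
      case 1
      then show ?thesis using c[of a s t] a st by (simp add: F_def algebra_simps)
    next
      case 2
      then show ?thesis using c[of s a t] a st by (simp add: F_def algebra_simps)
    next
      case 3
      then show ?thesis using c[of s t a] a st by (simp add: F_def algebra_simps)
    qed
  qed
  have near: "norm (F t - F s - g u * of_real (t - s)) \<le> e * (t - s)"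
    if st: "s \<in> T" "t \<in> T" "s \<le> t" and e: "\<And>x. x \<in> T \<Longrightarrow> s \<le> x \<Longrightarrow> x \<le> t \<Longrightarrow> norm (g x - g u) \<le> e"
    for s t u e
  proof -
    have "((\<lambda>x. G x - g u) has_integral (F t - F s - (t - s) *\<^sub>R g u)) {s..t}"
      unfolding diff[OF st]
      using st int[of s t] has_integral_const_real[of "g u" s t]
      by (intro has_integral_diff integrable_integral) auto
    moreover have "norm (G x - g u) \<le> e" if "x \<in> cbox s t" for x
      unfolding G_def
      using that floor_point_in_le[OF cl st(1), of x] floor_point_ge[of s T x] st
      by (intro e) auto
    moreover have "0 \<le> e"
      using e[of s] st by (meson norm_ge_zero order.refl order_trans)
    ultimately show ?thesis
      using has_integral_bound[of e "\<lambda>x. G x - g u" _ s t] st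
      by (simp add: scaleR_conv_of_real mult.commute)
  qed
  have "has_delta_deriv T F (g t) t" if t: "t \<in> ts_kappa T" for t
  proof -
    have tT: "t \<in> T"
      using t ts_kappa_subset by blast
    show ?thesis
    proof (cases "fwd_jump T t = t")
      case True
      have gt: "(g \<longlongrightarrow> g t) (at t within T)"
      proof (cases "is_maximum T t")
        case False
        then have "right_dense T t"
          using True tT by (auto simp: right_dense_def is_maximum_def not_le)
        then show ?thesis
          using g tT by (auto simp: rd_continuous_def)
      qed (rule gmax)
      show ?thesis
        unfolding has_delta_deriv_def True
      proof (intro allI impI)
        fix \<epsilon> :: real
        assume "\<epsilon> > 0"
        then obtain d where d: "d > 0"
          "\<And>s. s \<in> T \<Longrightarrow> 0 < dist s t \<Longrightarrow> dist s t < d \<Longrightarrow> dist (g s) (g t) < \<epsilon>"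
          using gt unfolding Lim_within by meson
        have close: "norm (g x - g t) \<le> \<epsilon>" if "x \<in> T" "\<bar>x - t\<bar> < d" for x
          using d(2)[of x] that \<open>\<epsilon> > 0\<close> by (cases "x = t") (auto simp: dist_norm)
        have "cmod (F t - F s - g t * of_real (t - s)) \<le> \<epsilon> * \<bar>t - s\<bar>"
          if s: "s \<in> T" "\<bar>s - t\<bar> < d" for s
        proof (cases "s \<le> t")
          case True
          then show ?thesis
            using near[of s t t \<epsilon>] close s tT by auto
        next
          case False
          have "cmod (F s - F t - g t * of_real (s - t)) \<le> \<epsilon> * (s - t)"
            using False close s tT by (intro near) auto
          moreover have "F s - F t - g t * of_real (s - t) = - (F t - F s - g t * of_real (t - s))"
            by (simp add: algebra_simps)
          ultimately show ?thesis
            using False by (metis abs_minus_commute abs_of_pos diff_gt_0_iff_gt norm_minus_cancel not_le)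
        qed
        then show "\<exists>\<delta>>0. \<forall>s\<in>{t - \<delta><..<t + \<delta>} \<inter> T.
            cmod (F t - F s - g t * of_real (t - s)) \<le> \<epsilon> * \<bar>t - s\<bar>"
          using d(1) by (intro exI[of _ d]) (auto simp: abs_less_iff)
      qed
    next
      case False
      then have lt: "t < fwd_jump T t"
        using fwd_jump_ge[OF tT] by simp
      let ?\<sigma> = "fwd_jump T t"
      have "?\<sigma> \<in> T"
        using cl tT by (rule fwd_jump_in)
      have "(G has_integral g t * of_real (graininess T t)) {t..?\<sigma>}"
      proof (rule has_integral_spike_finite[where S = "{?\<sigma>}"])
        show "((\<lambda>_. g t) has_integral g t * of_real (graininess T t)) {t..?\<sigma>}"
          using has_integral_const_real[of "g t" t ?\<sigma>] lt
          by (simp add: graininess_def scaleR_conv_of_real mult.commute)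
        fix x
        assume "x \<in> {t..?\<sigma>} - {?\<sigma>}"
        then have x: "t \<le> x" "x < ?\<sigma>" by auto
        have "floor_point T x = floor_point T t"
          using x fwd_jump_le[of _ T t] by (intro floor_point_gap) force+
        also have "\<dots> = t"
          using floor_point_in_le[OF cl tT, of t] floor_point_ge[of t T t] tT by simp
        finally show "G x = g t"
          by (simp add: G_def)
      qed simp
      then have jump: "F ?\<sigma> - F t = g t * of_real (graininess T t)"
        using diff[OF tT \<open>?\<sigma> \<in> T\<close>] lt by (simp add: integral_unique)
      have "(F \<longlongrightarrow> F t) (at t within T)"
      proof (cases "\<exists>s\<in>T. s < t")
        case False
        then have "\<forall>s\<in>T. dist s t < ?\<sigma> - t \<longrightarrow> s = t"
          using fwd_jump_le[of _ T t] by (force simp: dist_real_def)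
        then show ?thesis
          using lt unfolding Lim_within by (intro allI impI exI[of _ "?\<sigma> - t"]) auto
      next
        case True
        then obtain s where s: "s \<in> T" "s < t" by blast
        have "continuous_on {s..t} (\<lambda>x. integral {s..x} G)"
          using int[OF s(1)] by (rule indefinite_integral_continuous_1)
        then have "((\<lambda>x. integral {s..x} G) \<longlongrightarrow> integral {s..t} G) (at t within {s..t})"
          using s by (auto simp: continuous_on_def)
        then have "((\<lambda>x. F s + integral {s..x} G) \<longlongrightarrow> F s + integral {s..t} G) (at t within T \<inter> {s..t})"
          by (intro tendsto_intros) (rule tendsto_within_subset, auto)
        moreover have "F s + integral {s..x} G = F x" if "x \<in> T \<inter> {s..t}" for x
          using diff[of s x] that s by (simp add: algebra_simps)
        ultimately have lim: "(F \<longlongrightarrow> F t) (at t within T \<inter> {s..t})"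
          using s tT by (subst (asm) tendsto_cong[where g = F]) (auto simp: eventually_at_filter)
        \<comment> \<open>the gap to the right of \<open>t\<close> makes the approach one-sided\<close>
        have "at t within T \<inter> {s..t} = at t within T"
          using fwd_jump_le[of _ T t] lt s
          by (intro at_within_nhd[of t "{s<..<?\<sigma>}"]) force+
        with lim show ?thesis by simp
      qed
      with jump show ?thesis
        using has_delta_deriv_scattered[OF tT lt] by simp
    qed
  qed
  then show ?thesis by (rule that)
qed

section \<open>Calculus rules and first-order linear equations\<close>

lemma has_delta_deriv_cong:
  assumes "closed T" "t \<in> T" "\<And>s. s \<in> T \<Longrightarrow> f s = g s"
  shows "has_delta_deriv T f D t \<longleftrightarrow> has_delta_deriv T g D t"
  using assms fwd_jump_in[OF assms(1,2)] by (simp add: has_delta_deriv_def)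

lemma has_delta_deriv_cnj:
  assumes "has_delta_deriv T f D t"
  shows "has_delta_deriv T (\<lambda>s. cnj (f s)) (cnj D) t"
proof -
  have "cmod (cnj (f u) - cnj (f s) - cnj D * of_real x) = cmod (f u - f s - D * of_real x)" for u s x
    by (subst complex_mod_cnj[symmetric]) simp
  then show ?thesis
    using assms by (simp only: has_delta_deriv_def)
qed

lemma has_delta_deriv_lincomb:
  assumes "t \<in> T" "has_delta_deriv T f D t" "has_delta_deriv T g D' t"
  shows "has_delta_deriv T (\<lambda>s. a * f s + b * g s) (a * D + b * D') t"
proof (cases "fwd_jump T t = t")
  case True
  then show ?thesis
    using assms(2,3) unfolding has_delta_deriv_dense[OF assms(1) True]
    by (intro has_vector_derivative_add has_vector_derivative_mult_right)
next
  case False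
  then have "t < fwd_jump T t"
    using fwd_jump_ge[OF assms(1)] by simp
  from has_delta_deriv_scattered[OF assms(1) this] assms(2,3) show ?thesis
    by (auto intro!: tendsto_intros simp: algebra_simps eq_diff_eq)
qed

text \<open>
  The cylinder transformation is made for this chain rule: across a gap the exponential is
  multiplied by \<open>exp (\<mu> * cylinder \<mu> z) = 1 + \<mu> * z\<close>, which is what the dynamic equation
  demands.
\<close>

lemma has_delta_deriv_exp:
  assumes t: "t \<in> T" and F: "has_delta_deriv T F (cylinder (graininess T t) z) t"
    and nz: "1 + of_real (graininess T t) * z \<noteq> 0"
  shows "has_delta_deriv T (\<lambda>s. exp (F s - c)) (z * exp (F t - c)) t"
proof (cases "fwd_jump T t = t")
  case True
  have "((\<lambda>x. exp (x - c)) has_field_derivative exp (F t - c)) (at (F t) within F ` T)"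
    by (auto intro!: derivative_eq_intros)
  then show ?thesis
    using F field_vector_diff_chain_within[of F z t T "\<lambda>x. exp (x - c)"]
    unfolding has_delta_deriv_dense[OF t True]
    by (simp add: cylinder_def graininess_def True o_def)
next
  case False
  then have lt: "t < fwd_jump T t"
    using fwd_jump_ge[OF t] by simp
  let ?m = "graininess T t"
  have "?m \<noteq> 0"
    using lt by (simp add: graininess_def)
  have "(F \<longlongrightarrow> F t) (at t within T)" and j: "F (fwd_jump T t) = F t + Ln (1 + of_real ?m * z)"
    using F \<open>?m \<noteq> 0\<close> unfolding has_delta_deriv_scattered[OF t lt]
    by (auto simp: cylinder_def algebra_simps)
  moreover have "exp (F (fwd_jump T t) - c) = exp (F t - c) * (1 + of_real ?m * z)"
    using nz by (simp add: j exp_add exp_diff)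
  ultimately show ?thesis
    unfolding has_delta_deriv_scattered[OF t lt]
    by (auto intro!: tendsto_intros simp: algebra_simps)
qed

text \<open>
  At a scattered point both functions are multiplied by the same factor \<open>1 + \<mu> * q\<close>, which is
  nonzero since \<open>e\<close> does not vanish after the jump.
\<close>

lemma has_delta_deriv_quotient_zero:
  assumes t: "t \<in> T" and y: "has_delta_deriv T y (q * y t) t" and e: "has_delta_deriv T e (q * e t) t"
    and nz: "e t \<noteq> 0" "e (fwd_jump T t) \<noteq> 0"
  shows "has_delta_deriv T (\<lambda>s. y s / e s) 0 t"
proof (cases "fwd_jump T t = t")
  case True
  have "(inverse has_field_derivative - (inverse (e t) ^ Suc (Suc 0))) (at (e t) within e ` T)"
    using nz by (intro DERIV_inverse)
  from field_vector_diff_chain_within[OF e[unfolded has_delta_deriv_dense[OF t True]] this]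
    has_vector_derivative_mult[OF y[unfolded has_delta_deriv_dense[OF t True]]]
  have "((\<lambda>s. y s * (inverse \<circ> e) s) has_vector_derivative
      y t * (q * e t * - (inverse (e t) ^ Suc (Suc 0))) + q * y t * (inverse \<circ> e) t) (at t within T)"
    by blast
  moreover have "y t * (q * e t * - (inverse (e t) ^ Suc (Suc 0))) + q * y t * (inverse \<circ> e) t = 0"
    using nz by (simp add: field_simps)
  ultimately have "((\<lambda>s. y s * (inverse \<circ> e) s) has_vector_derivative 0) (at t within T)"
    by (simp only:)
  then show ?thesis
    unfolding has_delta_deriv_dense[OF t True] by (simp add: divide_inverse)
next
  case False
  then have lt: "t < fwd_jump T t"
    using fwd_jump_ge[OF t] by simp
  let ?f = "1 + q * of_real (graininess T t)"
  have "y (fwd_jump T t) = y t * ?f" "e (fwd_jump T t) = e t * ?f"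
    using has_delta_deriv_jump[OF t y] has_delta_deriv_jump[OF t e] by (auto simp: algebra_simps)
  then have "y (fwd_jump T t) / e (fwd_jump T t) = y t / e t"
    using nz by auto
  then show ?thesis
    using nz has_delta_deriv_continuous[OF t y] has_delta_deriv_continuous[OF t e]
    unfolding has_delta_deriv_scattered[OF t lt] by (auto intro!: tendsto_intros)
qed

lemma linear_solution_proportional:
  assumes T: "closed T" "a \<in> T" "b \<in> T" "a \<le> b"
    and y: "\<And>t. t \<in> T \<Longrightarrow> a \<le> t \<Longrightarrow> t < b \<Longrightarrow> has_delta_deriv T y (q t * y t) t"
    and e: "\<And>t. t \<in> T \<Longrightarrow> a \<le> t \<Longrightarrow> t < b \<Longrightarrow> has_delta_deriv T e (q t * e t) t"
    and nz: "\<And>t. t \<in> T \<Longrightarrow> e t \<noteq> 0"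
    and cont: "left_dense T b \<Longrightarrow> (y \<longlongrightarrow> y b) (at b within T)"
      "left_dense T b \<Longrightarrow> (e \<longlongrightarrow> e b) (at b within T)"
  shows "y a / e a = y b / e b"
proof (rule has_delta_deriv_zero_imp_eq[OF T])
  show "has_delta_deriv T (\<lambda>s. y s / e s) 0 t" if "t \<in> T" "a \<le> t" "t < b" for t
    using that y e nz fwd_jump_in[OF T(1)] by (intro has_delta_deriv_quotient_zero[where q = "q t"]) auto
  show "((\<lambda>s. y s / e s) \<longlongrightarrow> y b / e b) (at b within T)" if "left_dense T b"
    using cont[OF that] nz[OF T(3)] by (rule tendsto_divide)
qed

section \<open>The exponential function of a time scale\<close>

lemma has_delta_integral_unique:
  assumes T: "closed T" "a \<in> T" "b \<in> T"
    and I: "has_delta_integral T f I a b" and J: "has_delta_integral T f J a b"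
  shows "I = J"
proof -
  from I obtain F where F: "\<And>t. t \<in> ts_kappa T \<Longrightarrow> has_delta_deriv T F (f t) t" "I = F b - F a"
    by (auto simp: has_delta_integral_def)
  from J obtain G where G: "\<And>t. t \<in> ts_kappa T \<Longrightarrow> has_delta_deriv T G (f t) t" "J = G b - G a"
    by (auto simp: has_delta_integral_def)
  \<comment> \<open>written as a linear combination, to which the derivative rule applies\<close>
  define H where "H s = 1 * F s + (-1) * G s" for s
  have H: "has_delta_deriv T H 0 t" if "t \<in> ts_kappa T" for t
    using has_delta_deriv_lincomb[OF _ F(1) G(1), of t 1 "-1"] that ts_kappa_subset
    unfolding H_def by auto
  have eq: "H s = H t" if st: "s \<in> T" "t \<in> T" "s \<le> t" for s t
  proof (rule has_delta_deriv_zero_imp_eq[OF T(1) st])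
    show "has_delta_deriv T H 0 u" if "u \<in> T" "s \<le> u" "u < t" for u
      using that st by (intro H ts_kappa_not_last)
    show "(H \<longlongrightarrow> H t) (at t within T)" if "left_dense T t"
      using that st by (intro has_delta_deriv_continuous[OF _ H] ts_kappa_left_dense)
  qed
  then have "H a = H b"
    using T by (metis linear)
  moreover have "I - J = H b - H a"
    by (simp add: F(2) G(2) H_def)
  ultimately show ?thesis by simp
qed

lemma delta_integral_eqI:
  assumes "closed T" "a \<in> T" "b \<in> T" "has_delta_integral T f I a b"
  shows "delta_integral T f a b = I"
  unfolding delta_integral_def using assms has_delta_integral_unique by blast

text \<open>
  Gaps near a dense point \<open>t\<close> are short: one that starts to the left of \<open>t\<close> ends at \<open>t\<close> at the
  latest, and one that starts between \<open>t\<close> and a later point \<open>s\<close> of \<open>T\<close> ends at \<open>s\<close> at the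
  latest.
\<close>

lemma graininess_tendsto_left:
  "(graininess T \<longlongrightarrow> 0) (at t within T \<inter> {..<t})" if "t \<in> T"
  unfolding Lim_within
proof (intro allI impI)
  fix e :: real
  assume "e > 0"
  have "dist (graininess T s) 0 < e" if "s \<in> T \<inter> {..<t}" "dist s t < e" for s
    using that fwd_jump_le[OF \<open>t \<in> T\<close>, of s] fwd_jump_ge[of s T]
    by (auto simp: graininess_def dist_real_def)
  with \<open>e > 0\<close> show "\<exists>d>0. \<forall>x\<in>T \<inter> {..<t}. 0 < dist x t \<and> dist x t < d \<longrightarrow> dist (graininess T x) 0 < e"
    by blast
qed

lemma graininess_tendsto_dense:
  assumes t: "t \<in> T" "fwd_jump T t = t"
  shows "(graininess T \<longlongrightarrow> 0) (at t within T)"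
proof -
  have "(graininess T \<longlongrightarrow> 0) (at t within T \<inter> {t<..})"
    unfolding Lim_within
  proof (intro allI impI)
    fix e :: real
    assume "e > 0"
    show "\<exists>d>0. \<forall>x\<in>T \<inter> {t<..}. 0 < dist x t \<and> dist x t < d \<longrightarrow> dist (graininess T x) 0 < e"
    proof (cases "\<exists>s\<in>T. t < s")
      case True
      then have "right_dense T t"
        using t by (simp add: right_dense_def)
      then obtain s' where s': "s' \<in> T" "t < s'" "s' < t + e"
        unfolding right_dense_iff using \<open>e > 0\<close> by blast
      have "dist (graininess T s) 0 < e" if "s \<in> T \<inter> {t<..}" "dist s t < s' - t" for s
        using that fwd_jump_le[OF s'(1), of s] fwd_jump_ge[of s T] s'
        by (auto simp: graininess_def dist_real_def)
      then show ?thesis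
        using s'(2) by (intro exI[of _ "s' - t"]) auto
    next
      case False
      then show ?thesis
        by (intro exI[of _ 1]) auto
    qed
  qed
  then have "(graininess T \<longlongrightarrow> 0) (at t within (T \<inter> {..<t}) \<union> (T \<inter> {t<..}))"
    using graininess_tendsto_left[OF t(1)] by (simp add: Lim_within_Un)
  moreover have "at t within (T \<inter> {..<t}) \<union> (T \<inter> {t<..}) = at t within T"
    unfolding at_within_def by (rule arg_cong[where f = "\<lambda>S. inf (nhds t) (principal S)"]) auto
  ultimately show ?thesis by simp
qed

text \<open>
  The cylinder transformation is jointly continuous at graininess zero, as \<open>cylinder h z = z *
  \<phi> (h * z)\<close> with \<open>\<phi> w = Ln (1 + w) / w\<close>, which extends continuously by \<open>\<phi> 0 = 1\<close>. This formula
  covers \<open>h = 0\<close> and \<open>z = 0\<close> too.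
\<close>

lemma cylinder_tendsto:
  fixes l :: complex
  assumes h: "(h \<longlongrightarrow> 0) A" and z: "(z \<longlongrightarrow> l) A"
  shows "((\<lambda>x. cylinder (h x) (z x)) \<longlongrightarrow> l) A"
proof -
  define \<phi> :: "complex \<Rightarrow> complex" where "\<phi> w = (if w = 0 then 1 else Ln (1 + w) / w)" for w
  have eq: "cylinder h z = z * \<phi> (of_real h * z)" for h z
    by (auto simp: cylinder_def \<phi>_def)
  have "((\<lambda>w. Ln (1 + w)) has_field_derivative 1) (at 0)"
    by (auto intro!: derivative_eq_intros)
  then have "((\<lambda>w. Ln (1 + w) / w) \<longlongrightarrow> 1) (at 0)"
    by (simp add: has_field_derivative_iff)
  then have "(\<phi> \<longlongrightarrow> 1) (at 0)"
    by (rule Lim_transform_eventually) (auto simp: \<phi>_def eventually_at_filter)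
  then have "isCont \<phi> 0"
    by (simp add: isCont_def \<phi>_def)
  moreover have "((\<lambda>x. of_real (h x) * z x) \<longlongrightarrow> of_real 0 * l) A"
    by (intro tendsto_intros h z)
  ultimately have "((\<lambda>x. \<phi> (of_real (h x) * z x)) \<longlongrightarrow> \<phi> 0) A"
    by (intro isCont_tendsto_compose[of 0 \<phi>]) auto
  then have "((\<lambda>x. z x * \<phi> (of_real (h x) * z x)) \<longlongrightarrow> l * \<phi> 0) A"
    by (intro tendsto_intros z)
  then show ?thesis
    by (simp add: eq \<phi>_def)
qed

text \<open>
  The integrand \<open>cylinder \<mu> q\<close> inherits rd-continuity from \<open>q\<close> because the graininess tends to
  zero at each dense point.
\<close>

lemma delta_exp_antiderivative:
  assumes T: "time_scale T" and q: "exponent_regular T q"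
  obtains F where "\<And>t. t \<in> ts_kappa T \<Longrightarrow> has_delta_deriv T F (cylinder (graininess T t) (q t)) t"
    and "\<And>s t. s \<in> T \<Longrightarrow> t \<in> T \<Longrightarrow> delta_exp T q t s = exp (F t - F s)"
proof -
  have cl: "closed T"
    using T by (simp add: time_scale_def)
  define g where "g t = cylinder (graininess T t) (q t)" for t
  have lim: "(g \<longlongrightarrow> g t) (at t within T)"
    if "t \<in> T" "fwd_jump T t = t" "(q \<longlongrightarrow> q t) (at t within T)" for t
  proof -
    have "g t = q t"
      using that(2) by (simp add: g_def cylinder_def graininess_def)
    then show ?thesis
      using cylinder_tendsto[OF graininess_tendsto_dense[OF that(1,2)] that(3)]
      by (simp add: g_def[abs_def])
  qed
  have "rd_continuous T g"
    unfolding rd_continuous_def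
  proof (intro conjI ballI impI)
    fix t
    assume t: "t \<in> T"
    show "(g \<longlongrightarrow> g t) (at t within T)" if "right_dense T t"
      using that q t by (intro lim) (auto simp: exponent_regular_def rd_continuous_def right_dense_def)
    show "\<exists>l. (g \<longlongrightarrow> l) (at t within T \<inter> {..<t})" if ld: "left_dense T t"
    proof -
      obtain l where "(q \<longlongrightarrow> l) (at t within T \<inter> {..<t})"
        using ld q t by (auto simp: exponent_regular_def rd_continuous_def)
      from cylinder_tendsto[OF graininess_tendsto_left[OF t] this] show ?thesis
        unfolding g_def by blast
    qed
  qed
  moreover have "(g \<longlongrightarrow> g m) (at m within T)" if "is_maximum T m" for m
    using that q fwd_jump_maximum[of m T]
    by (intro lim) (auto simp: exponent_regular_def is_maximum_def)
  ultimately obtain F where F: "\<And>t. t \<in> ts_kappa T \<Longrightarrow> has_delta_deriv T F (g t) t"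
    using delta_antiderivative_exists[OF T] by blast
  have "delta_exp T q t s = exp (F t - F s)" if "s \<in> T" "t \<in> T" for s t
  proof -
    have "has_delta_integral T g (F t - F s) s t"
      using F by (auto simp: has_delta_integral_def)
    from delta_integral_eqI[OF cl that this] show ?thesis
      by (simp add: delta_exp_def g_def[abs_def])
  qed
  with F show ?thesis
    unfolding g_def by (rule that)
qed

lemma delta_exp_deriv:
  assumes T: "time_scale T" and q: "exponent_regular T q"
    and t: "t \<in> ts_kappa T" "1 + of_real (graininess T t) * q t \<noteq> 0" and s: "s \<in> T"
  shows "has_delta_deriv T (\<lambda>t. delta_exp T q t s) (q t * delta_exp T q t s) t"
proof -
  obtain F where F: "\<And>t. t \<in> ts_kappa T \<Longrightarrow> has_delta_deriv T F (cylinder (graininess T t) (q t)) t"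
    "\<And>s t. s \<in> T \<Longrightarrow> t \<in> T \<Longrightarrow> delta_exp T q t s = exp (F t - F s)"
    using delta_exp_antiderivative[OF T q] by blast
  have tT: "t \<in> T"
    using t ts_kappa_subset by blast
  have "has_delta_deriv T (\<lambda>t. exp (F t - F s)) (q t * exp (F t - F s)) t"
    using F(1)[OF t(1)] t(2) by (intro has_delta_deriv_exp tT)
  moreover have "closed T"
    using T by (simp add: time_scale_def)
  ultimately show ?thesis
    using has_delta_deriv_cong[OF _ tT, of "\<lambda>t. delta_exp T q t s" "\<lambda>t. exp (F t - F s)"] F(2) s tT
    by simp
qed

lemma cylinder_cnj:
  assumes "1 + of_real h * z \<notin> \<real>\<^sub>\<le>\<^sub>0"
  shows "cylinder h (cnj z) = cnj (cylinder h z)"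
  using cnj_Ln[OF assms] by (simp add: cylinder_def)

text \<open>
  Conjugation commutes with the delta integral, and with the principal logarithm off its branch
  cut.
\<close>

lemma delta_exp_cnj:
  assumes T: "time_scale T" and q: "exponent_regular T q"
    and reg: "\<And>t. t \<in> ts_kappa T \<Longrightarrow> 1 + of_real (graininess T t) * q t \<notin> \<real>\<^sub>\<le>\<^sub>0"
    and st: "s \<in> T" "t \<in> T"
  shows "delta_exp T (\<lambda>\<tau>. cnj (q \<tau>)) t s = cnj (delta_exp T q t s)"
proof -
  obtain F where F: "\<And>t. t \<in> ts_kappa T \<Longrightarrow> has_delta_deriv T F (cylinder (graininess T t) (q t)) t"
    "\<And>s t. s \<in> T \<Longrightarrow> t \<in> T \<Longrightarrow> delta_exp T q t s = exp (F t - F s)"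
    using delta_exp_antiderivative[OF T q] by blast
  have "has_delta_integral T (\<lambda>\<tau>. cylinder (graininess T \<tau>) (cnj (q \<tau>))) (cnj (F t) - cnj (F s)) s t"
    unfolding has_delta_integral_def
    using has_delta_deriv_cnj[OF F(1)] cylinder_cnj[OF reg]
    by (intro exI[of _ "\<lambda>t. cnj (F t)"]) auto
  moreover have "closed T"
    using T by (simp add: time_scale_def)
  ultimately have "delta_exp T (\<lambda>\<tau>. cnj (q \<tau>)) t s = exp (cnj (F t) - cnj (F s))"
    using delta_integral_eqI[OF _ st] by (simp add: delta_exp_def)
  then show ?thesis
    using F(2)[OF st] by (simp add: exp_cnj)
qed

section \<open>Eigenfunctions of the conformable derivative\<close>

lemma has_conf_deriv_eigen_iff:
  assumes "k0 \<alpha> t \<noteq> 0"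
  shows "has_conf_deriv T k0 k1 \<alpha> w (r t * w t) t \<longleftrightarrow>
    has_delta_deriv T w (conf_exponent k0 k1 \<alpha> r t * w t) t"
proof -
  have "r t * w t = of_real (k1 \<alpha> t) * w t + of_real (k0 \<alpha> t) * D \<longleftrightarrow>
      D = conf_exponent k0 k1 \<alpha> r t * w t" for D
    using assms by (auto simp: conf_exponent_def field_simps)
  then show ?thesis
    by (simp add: has_conf_deriv_def)
qed

lemma has_conf_deriv_lincomb:
  assumes "t \<in> T" "has_conf_deriv T k0 k1 \<alpha> f D t" "has_conf_deriv T k0 k1 \<alpha> g D' t"
  shows "has_conf_deriv T k0 k1 \<alpha> (\<lambda>s. a * f s + b * g s) (a * D + b * D') t"
proof -
  obtain f' g' where d: "has_delta_deriv T f f' t" "D = of_real (k1 \<alpha> t) * f t + of_real (k0 \<alpha> t) * f'"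
    "has_delta_deriv T g g' t" "D' = of_real (k1 \<alpha> t) * g t + of_real (k0 \<alpha> t) * g'"
    using assms(2,3) by (auto simp: has_conf_deriv_def)
  have "a * D + b * D' = of_real (k1 \<alpha> t) * (a * f t + b * g t) + of_real (k0 \<alpha> t) * (a * f' + b * g')"
    by (simp add: d algebra_simps)
  with has_delta_deriv_lincomb[OF assms(1) d(1,3), of a b] show ?thesis
    unfolding has_conf_deriv_def by blast
qed

lemma has_conf_deriv_cong:
  assumes "closed T" "t \<in> T" "\<And>s. s \<in> T \<Longrightarrow> f s = g s"
  shows "has_conf_deriv T k0 k1 \<alpha> f D t \<longleftrightarrow> has_conf_deriv T k0 k1 \<alpha> g D t"
  using assms has_delta_deriv_cong[OF assms] by (simp add: has_conf_deriv_def)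

text \<open>
  Since \<open>k0\<close> does not vanish, a conformable derivative determines the delta derivative, hence
  the next value.
\<close>

lemma has_conf_deriv_determines_jump:
  assumes "t \<in> T" "k0 \<alpha> t \<noteq> 0" "f t = g t"
    and "has_conf_deriv T k0 k1 \<alpha> f D t" "has_conf_deriv T k0 k1 \<alpha> g D t"
  shows "f (fwd_jump T t) = g (fwd_jump T t)"
proof -
  obtain f' g' where d: "has_delta_deriv T f f' t" "D = of_real (k1 \<alpha> t) * f t + of_real (k0 \<alpha> t) * f'"
    "has_delta_deriv T g g' t" "D = of_real (k1 \<alpha> t) * g t + of_real (k0 \<alpha> t) * g'"
    using assms(4,5) unfolding has_conf_deriv_def by blast
  then have "f' = g'"
    using assms(2,3) by auto
  then show ?thesis
    using has_delta_deriv_jump[OF assms(1) d(1)] has_delta_deriv_jump[OF assms(1) d(3)] assms(3) by simp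
qed

text \<open>
  The point \<open>a\<close> excludes a singleton. The maximum is not left-dense, so some interval below it
  misses \<open>T\<close>, and the predecessor is the floor of the lower end of that interval.
\<close>

lemma scattered_maximum_predecessor:
  assumes T: "closed T" "a \<in> T" "a \<noteq> m" and m: "is_maximum T m" "left_scattered T m"
  obtains t where "t \<in> ts_kappa T" "fwd_jump T t = m"
proof -
  have "m \<in> T" "a < m"
    using m(1) T by (auto simp: is_maximum_def less_le)
  have "\<not> left_dense T m"
    using m by (simp add: left_scattered_def left_dense_def)
  then obtain d where d: "d > 0" "\<And>s. s \<in> T \<Longrightarrow> s < m \<Longrightarrow> s \<le> m - d"
    unfolding left_dense_iff by (meson not_le)
  define t where "t = floor_point T (m - d)"
  have t: "t \<in> T" "t \<le> m - d"
    unfolding t_def using floor_point_in_le[OF T(1,2)] d(2)[OF T(2) \<open>a < m\<close>] by auto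
  have gap: "m \<le> s" if "s \<in> T" "t < s" for s
    using that d floor_point_ge[of s T "m - d"] unfolding t_def by force
  have "t < m"
    using t d by simp
  have "fwd_jump T t \<le> m"
    using fwd_jump_le[OF \<open>m \<in> T\<close> \<open>t < m\<close>] .
  moreover have "fwd_jump T t \<noteq> t"
    using gap \<open>t < m\<close> \<open>m \<in> T\<close> right_dense_iff[of T t]
    by (metis add_diff_cancel_left' diff_gt_0_iff_gt not_le right_dense_def add.commute diff_add_cancel)
  ultimately have "fwd_jump T t = m"
    using gap[OF fwd_jump_in[OF T(1) t(1)]] fwd_jump_ge[OF t(1)] by simp
  with ts_kappa_not_last[OF t(1) \<open>m \<in> T\<close> \<open>t < m\<close>] show ?thesis
    by (rule that)
qed

text \<open>
  Between two points of \<open>ts_kappa T\<close>, all points before the right end lie in \<open>ts_kappa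
  (ts_kappa T)\<close>, so the quotient of the two functions is constant once it is continuous at the
  right end. There, continuity is an issue only at a left-dense point, which belongs to
  \<open>ts_kappa (ts_kappa T)\<close> as well. The conclusion leaves out a left-scattered maximum of \<open>T\<close>,
  where \<open>w\<close> may be arbitrary: if its predecessor is left-scattered, no equation involves the
  value there.
\<close>

lemma eigenfunctions_proportional:
  assumes T: "closed T" and k0: "\<And>t. t \<in> T \<Longrightarrow> k0 \<alpha> t \<noteq> 0"
    and w: "\<And>t. t \<in> ts_kappa (ts_kappa T) \<Longrightarrow> has_conf_deriv T k0 k1 \<alpha> w (r * w t) t"
    and e: "\<And>t. t \<in> ts_kappa (ts_kappa T) \<Longrightarrow> has_conf_deriv T k0 k1 \<alpha> e (r * e t) t"
    and nz: "\<And>t. t \<in> T \<Longrightarrow> e t \<noteq> 0"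
  shows "\<exists>c. \<forall>t\<in>ts_kappa T. w t = c * e t"
proof -
  let ?q = "conf_exponent k0 k1 \<alpha> (\<lambda>_. r)"
  have sub: "ts_kappa T \<subseteq> T" "ts_kappa (ts_kappa T) \<subseteq> T"
    using ts_kappa_subset by blast+
  have wd: "has_delta_deriv T w (?q t * w t) t" and ed: "has_delta_deriv T e (?q t * e t) t"
    if "t \<in> ts_kappa (ts_kappa T)" for t
    using w[OF that] e[OF that] has_conf_deriv_eigen_iff[of k0 \<alpha> t T k1 _ "\<lambda>_. r"] k0 that sub by auto
  have le: "w s / e s = w t / e t" if st: "s \<in> ts_kappa T" "t \<in> ts_kappa T" "s \<le> t" for s t
  proof (rule linear_solution_proportional[OF T])
    show "s \<in> T" "t \<in> T" "s \<le> t"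
      using st sub by auto
    fix u
    assume "u \<in> T" "s \<le> u" "u < t"
    then have "u \<in> ts_kappa (ts_kappa T)"
      using st sub by (meson subsetD ts_kappa_not_last)
    then show "has_delta_deriv T w (?q u * w u) u" "has_delta_deriv T e (?q u * e u) u"
      by (rule wd, rule ed)
  next
    assume ld: "left_dense T t"
    have "left_dense (ts_kappa T) t"
      unfolding left_dense_iff
      using ld st sub unfolding left_dense_iff by (meson subsetD ts_kappa_not_last)
    with st(2) have "t \<in> ts_kappa (ts_kappa T)"
      by (rule ts_kappa_left_dense)
    then show "(w \<longlongrightarrow> w t) (at t within T)" "(e \<longlongrightarrow> e t) (at t within T)"
      using wd ed sub by (blast intro: has_delta_deriv_continuous)+
  qed (rule nz)
  show ?thesis
  proof (cases "ts_kappa T = {}")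
    case False
    then obtain a where a: "a \<in> ts_kappa T" by blast
    have "w t = w a / e a * e t" if "t \<in> ts_kappa T" for t
    proof -
      have "w a / e a = w t / e t"
        using le[OF a that] le[OF that a] by (metis linear)
      then show ?thesis
        using nz[of t] that sub by auto
    qed
    then show ?thesis by blast
  qed simp
qed

section \<open>The oscillator equation\<close>

text \<open>
  With \<open>c = \<i> * \<gamma>\<close> and \<open>u\<close> the first conformable derivative of \<open>y\<close>, the functions \<open>u + c * y\<close>
  and \<open>u - c * y\<close> are eigenfunctions for \<open>c\<close> and \<open>- c\<close>, hence multiples of \<open>p\<close> and \<open>n\<close> on
  \<open>ts_kappa T\<close>. Half their difference divided by \<open>c\<close> is \<open>y\<close>. At a left-scattered maximum \<open>u\<close> is
  not tied to \<open>y\<close>, and the value of \<open>y\<close> is recovered from the predecessor instead.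
\<close>

lemma solves_conf_oscillator_iff:
  fixes p n :: "real \<Rightarrow> complex"
  assumes T: "closed T" "t0 \<in> ts_kappa T" and k0: "\<And>t. t \<in> T \<Longrightarrow> k0 \<alpha> t \<noteq> 0" and "\<gamma> \<noteq> 0"
    and p: "\<And>t. t \<in> ts_kappa T \<Longrightarrow> has_conf_deriv T k0 k1 \<alpha> p (\<i> * of_real \<gamma> * p t) t"
    and n: "\<And>t. t \<in> ts_kappa T \<Longrightarrow> has_conf_deriv T k0 k1 \<alpha> n (- (\<i> * of_real \<gamma>) * n t) t"
    and nz: "\<And>t. t \<in> T \<Longrightarrow> p t \<noteq> 0" "\<And>t. t \<in> T \<Longrightarrow> n t \<noteq> 0"
  shows "solves_conf_oscillator T k0 k1 \<alpha> \<gamma> y \<longleftrightarrow> (\<exists>a b. \<forall>t\<in>T. y t = a * p t + b * n t)"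
proof
  define c where "c = \<i> * complex_of_real \<gamma>"
  have c: "c \<noteq> 0" "(of_real \<gamma>)\<^sup>2 = - c\<^sup>2"
    using \<open>\<gamma> \<noteq> 0\<close> by (auto simp: c_def power_mult_distrib)
  note p = p[folded c_def] and n = n[folded c_def]
  have sub: "ts_kappa T \<subseteq> T" "ts_kappa (ts_kappa T) \<subseteq> ts_kappa T"
    using ts_kappa_subset by blast+
  {
    assume "\<exists>a b. \<forall>t\<in>T. y t = a * p t + b * n t"
    then obtain a b where y: "\<And>t. t \<in> T \<Longrightarrow> y t = a * p t + b * n t" by blast
    \<comment> \<open>the first conformable derivative on \<open>ts_kappa T\<close>, continued by the same formula to a maximum\<close>
    define u where "u t = (a * c) * p t + (- b * c) * n t" for t
    have "has_conf_deriv T k0 k1 \<alpha> y (u t) t" if "t \<in> ts_kappa T" for t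
    proof -
      have "t \<in> T" using that sub by blast
      then show ?thesis
        using has_conf_deriv_lincomb[OF _ p n, of t a b] that has_conf_deriv_cong[OF T(1) _ y]
        by (simp add: u_def algebra_simps)
    qed
    moreover have "has_conf_deriv T k0 k1 \<alpha> u (c\<^sup>2 * y t) t" if "t \<in> ts_kappa T" for t
    proof -
      have "t \<in> T" using that sub by blast
      then show ?thesis
        using has_conf_deriv_lincomb[OF _ p n, of t "a * c" "- b * c"] that y[of t]
        unfolding u_def by (simp add: algebra_simps power2_eq_square)
    qed
    ultimately show "solves_conf_oscillator T k0 k1 \<alpha> \<gamma> y"
      unfolding solves_conf_oscillator_def using c(2) sub
      by (intro exI[of _ u] conjI ballI exI[of _ "c\<^sup>2 * y _"]) auto
  }
  {
    assume "solves_conf_oscillator T k0 k1 \<alpha> \<gamma> y"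
    then obtain u where u: "\<And>t. t \<in> ts_kappa T \<Longrightarrow> has_conf_deriv T k0 k1 \<alpha> y (u t) t"
      and v: "\<And>t. t \<in> ts_kappa (ts_kappa T) \<Longrightarrow> \<exists>v. has_conf_deriv T k0 k1 \<alpha> u v t \<and> v - c\<^sup>2 * y t = 0"
      unfolding solves_conf_oscillator_def c(2) by auto
    have uy: "has_conf_deriv T k0 k1 \<alpha> (\<lambda>s. 1 * u s + b * y s) (1 * (c\<^sup>2 * y t) + b * u t) t"
      if "t \<in> ts_kappa (ts_kappa T)" for t b
      using v[OF that] u[of t] sub that by (intro has_conf_deriv_lincomb) auto
    have "\<exists>A. \<forall>t\<in>ts_kappa T. u t + c * y t = A * p t"
    proof (rule eigenfunctions_proportional[OF T(1), of k0 \<alpha> k1 _ c])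
      fix t
      assume t: "t \<in> ts_kappa (ts_kappa T)"
      show "has_conf_deriv T k0 k1 \<alpha> (\<lambda>t. u t + c * y t) (c * (u t + c * y t)) t"
        using uy[OF t, of "c"] by (simp add: algebra_simps power2_eq_square)
      show "has_conf_deriv T k0 k1 \<alpha> p (c * p t) t"
        using p t sub by auto
    qed (rule k0 nz, assumption)+
    then obtain A where A: "\<And>t. t \<in> ts_kappa T \<Longrightarrow> u t + c * y t = A * p t" by blast
    have "\<exists>B. \<forall>t\<in>ts_kappa T. u t - c * y t = B * n t"
    proof (rule eigenfunctions_proportional[OF T(1), of k0 \<alpha> k1 _ "- c"])
      fix t
      assume t: "t \<in> ts_kappa (ts_kappa T)"
      show "has_conf_deriv T k0 k1 \<alpha> (\<lambda>t. u t - c * y t) (- c * (u t - c * y t)) t"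
        using uy[OF t, of "- c"] by (simp add: algebra_simps power2_eq_square)
      show "has_conf_deriv T k0 k1 \<alpha> n (- c * n t) t"
        using n t sub by auto
    qed (rule k0 nz, assumption)+
    then obtain B where B: "\<And>t. t \<in> ts_kappa T \<Longrightarrow> u t - c * y t = B * n t" by blast
    define z where "z t = A / (2 * c) * p t + (- B / (2 * c)) * n t" for t
    have yz: "y t = z t" if "t \<in> ts_kappa T" for t
      using A[OF that] B[OF that] c(1) by (simp add: z_def field_simps)
    have uz: "has_conf_deriv T k0 k1 \<alpha> z (u t) t" if "t \<in> ts_kappa T" for t
    proof -
      have "A / (2 * c) * (c * p t) + (- B / (2 * c)) * (- c * n t) = (A * p t + B * n t) / 2"
        using c(1) by (simp add: field_simps)
      also have "\<dots> = u t"
        unfolding A[OF that, symmetric] B[OF that, symmetric] by simp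
      finally show ?thesis
        using has_conf_deriv_lincomb[OF _ p n, of t "A / (2 * c)" "- B / (2 * c)"] that sub
        unfolding z_def by auto
    qed
    \<comment> \<open>\<open>z\<close> has the same first conformable derivative \<open>u\<close> as \<open>y\<close>, so equality passes from the predecessor to a maximum\<close>
    have "y t = z t" if t: "t \<in> T" for t
    proof (cases "t \<in> ts_kappa T")
      case False
      then have m: "is_maximum T t" "left_scattered T t"
        using maximum_outside_ts_kappa[OF t] by auto
      have "t0 \<in> T" "t0 \<noteq> t"
        using T(2) False sub by auto
      then obtain s where s: "s \<in> ts_kappa T" "fwd_jump T s = t"
        using scattered_maximum_predecessor[OF T(1) _ _ m] by metis
      have "y (fwd_jump T s) = z (fwd_jump T s)"
        using s(1) sub k0
        by (intro has_conf_deriv_determines_jump[where D = "u s" and f = y and g = z, OF _ _ yz u uz]) auto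
      then show ?thesis
        unfolding s(2) .
    qed (rule yz)
    then show "\<exists>a b. \<forall>t\<in>T. y t = a * p t + b * n t"
      unfolding z_def by blast
  }
qed

text \<open>
  The imaginary part \<open>\<mu> * \<gamma> / k0\<close> vanishes only for \<open>\<mu> = 0\<close>, where the value is 1. So \<open>1 + \<mu> *
  q\<close> avoids not only zero but the whole branch cut of the logarithm.
\<close>

lemma conf_exponent_regressive:
  assumes "k0 \<alpha> t \<noteq> 0" "\<gamma> \<noteq> 0"
  shows "1 + of_real \<mu> * conf_exponent k0 k1 \<alpha> (\<lambda>_. \<i> * of_real \<gamma>) t \<notin> \<real>\<^sub>\<le>\<^sub>0"
proof (cases "\<mu> = 0")
  case False
  have "Im (1 + of_real \<mu> * conf_exponent k0 k1 \<alpha> (\<lambda>_. \<i> * of_real \<gamma>) t) = \<mu> * \<gamma> / k0 \<alpha> t"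
    by (simp add: conf_exponent_def)
  also have "\<dots> \<noteq> 0"
    using assms False by simp
  finally show ?thesis
    by (auto simp: complex_nonpos_Reals_iff)
qed simp

lemma conf_exp_has_conf_deriv:
  assumes T: "time_scale T" and t0: "t0 \<in> T" and t: "t \<in> ts_kappa T"
    and k0: "k0 \<alpha> t \<noteq> 0" and "\<gamma> \<noteq> 0"
    and reg: "exponent_regular T (conf_exponent k0 k1 \<alpha> (\<lambda>_. \<i> * of_real \<gamma>))"
  shows "has_conf_deriv T k0 k1 \<alpha> (\<lambda>t. conf_exp T k0 k1 \<alpha> (\<lambda>_. \<i> * of_real \<gamma>) t t0)
    (\<i> * of_real \<gamma> * conf_exp T k0 k1 \<alpha> (\<lambda>_. \<i> * of_real \<gamma>) t t0) t"
proof -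
  let ?q = "conf_exponent k0 k1 \<alpha> (\<lambda>_. \<i> * of_real \<gamma>)"
  have "1 + of_real (graininess T t) * ?q t \<noteq> 0"
    using conf_exponent_regressive[of k0 \<alpha> t \<gamma> "graininess T t" k1] k0 \<open>\<gamma> \<noteq> 0\<close> by force
  from delta_exp_deriv[OF T reg t this t0] show ?thesis
    using k0 has_conf_deriv_eigen_iff[of k0 \<alpha> t T k1 "\<lambda>t. delta_exp T ?q t t0" "\<lambda>_. \<i> * of_real \<gamma>"]
    by (simp add: conf_exp_def)
qed

lemma conf_exp_cnj:
  assumes T: "time_scale T" and st: "t0 \<in> T" "t \<in> T"
    and k0: "\<And>t. t \<in> T \<Longrightarrow> k0 \<alpha> t \<noteq> 0" and "\<gamma> \<noteq> 0"
    and reg: "exponent_regular T (conf_exponent k0 k1 \<alpha> (\<lambda>_. \<i> * of_real \<gamma>))"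
  shows "conf_exp T k0 k1 \<alpha> (\<lambda>_. - (\<i> * of_real \<gamma>)) t t0 =
    cnj (conf_exp T k0 k1 \<alpha> (\<lambda>_. \<i> * of_real \<gamma>) t t0)"
proof -
  let ?q = "conf_exponent k0 k1 \<alpha> (\<lambda>_. \<i> * of_real \<gamma>)"
  have "conf_exponent k0 k1 \<alpha> (\<lambda>_. - (\<i> * of_real \<gamma>)) = (\<lambda>\<tau>. cnj (?q \<tau>))"
    by (simp add: conf_exponent_def fun_eq_iff)
  moreover have "1 + of_real (graininess T \<tau>) * ?q \<tau> \<notin> \<real>\<^sub>\<le>\<^sub>0" if "\<tau> \<in> ts_kappa T" for \<tau>
    using that k0 \<open>\<gamma> \<noteq> 0\<close> ts_kappa_subset by (intro conf_exponent_regressive) blast+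
  ultimately show ?thesis
    using delta_exp_cnj[OF T reg _ st] by (simp add: conf_exp_def)
qed

lemma exponential_span_eq_trig_span:
  fixes p n :: "real \<Rightarrow> complex"
  shows "(\<exists>a b. \<forall>t\<in>T. y t = a * p t + b * n t) \<longleftrightarrow>
    (\<exists>c1 c2. \<forall>t\<in>T. y t = c1 * ((p t + n t) / 2) + c2 * ((p t - n t) / (2 * \<i>)))"
proof -
  have 1: "a * P + b * N = (a + b) * ((P + N) / 2) + \<i> * (a - b) * ((P - N) / (2 * \<i>))" for a b P N :: complex
    by (simp add: field_simps)
  have 2: "c1 * ((P + N) / 2) + c2 * ((P - N) / (2 * \<i>)) =
      (c1 / 2 + c2 / (2 * \<i>)) * P + (c1 / 2 - c2 / (2 * \<i>)) * N" for c1 c2 P N :: complex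
    by (simp add: field_simps)
  show ?thesis
    using 1 2 by (metis (no_types, lifting))
qed

theorem theorem3p31:
  fixes T :: "real set"
    and k0 k1 :: "real \<Rightarrow> real \<Rightarrow> real"
    and \<alpha> \<gamma> t0 :: real
    and y :: "real \<Rightarrow> complex"
  assumes "time_scale T"
    and "\<alpha> \<in> {0<..1}"
    and "t0 \<in> ts_kappa T"
    and "\<gamma> \<noteq> 0"
    and "admissible_pair T k0 k1"
    and "\<forall>t\<in>ts_kappa T.
           (k0 \<alpha> t)\<^sup>2 - 2 * graininess T t * k0 \<alpha> t * k1 \<alpha> t
             + (graininess T t)\<^sup>2 * (\<gamma>\<^sup>2 + (k1 \<alpha> t)\<^sup>2) \<noteq> 0"
    and "exponent_regular T (conf_exponent k0 k1 \<alpha> (\<lambda>_. \<i> * of_real \<gamma>))"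
    and "exponent_regular T (conf_exponent k0 k1 \<alpha> (\<lambda>_. - (\<i> * of_real \<gamma>)))"
  shows "(solves_conf_oscillator T k0 k1 \<alpha> \<gamma> y \<longleftrightarrow>
           (\<exists>c1 c2 :: complex. \<forall>t\<in>T.
              y t = c1 * conf_cos T k0 k1 \<alpha> \<gamma> t t0 + c2 * conf_sin T k0 k1 \<alpha> \<gamma> t t0)) \<and>
         (solves_conf_oscillator T k0 k1 \<alpha> \<gamma> y \<and> (\<forall>t\<in>T. y t \<in> \<real>) \<longleftrightarrow>
           (\<exists>c1 c2 :: real. \<forall>t\<in>T.
              y t = of_real c1 * conf_cos T k0 k1 \<alpha> \<gamma> t t0
                    + of_real c2 * conf_sin T k0 k1 \<alpha> \<gamma> t t0))"
proof -
  have cl: "closed T"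
    using assms(1) by (simp add: time_scale_def)
  have t0: "t0 \<in> T"
    using assms(3) ts_kappa_subset by blast
  have k0: "k0 \<alpha> t \<noteq> 0" if "t \<in> T" for t
    using assms(2,5) that by (auto simp: admissible_pair_def)
  let ?p = "\<lambda>t. conf_exp T k0 k1 \<alpha> (\<lambda>_. \<i> * of_real \<gamma>) t t0"
  let ?n = "\<lambda>t. conf_exp T k0 k1 \<alpha> (\<lambda>_. - (\<i> * of_real \<gamma>)) t t0"
  let ?cos = "\<lambda>t. conf_cos T k0 k1 \<alpha> \<gamma> t t0" and ?sin = "\<lambda>t. conf_sin T k0 k1 \<alpha> \<gamma> t t0"
  have p: "has_conf_deriv T k0 k1 \<alpha> ?p (\<i> * of_real \<gamma> * ?p t) t" if "t \<in> ts_kappa T" for t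
    using that ts_kappa_subset k0
    by (intro conf_exp_has_conf_deriv[OF assms(1) t0 _ _ assms(4,7)]) auto
  \<comment> \<open>the second exponential is the first one for \<open>- \<gamma>\<close>\<close>
  have n: "has_conf_deriv T k0 k1 \<alpha> ?n (- (\<i> * of_real \<gamma>) * ?n t) t" if "t \<in> ts_kappa T" for t
    using conf_exp_has_conf_deriv[OF assms(1) t0 that, of k0 \<alpha> "- \<gamma>" k1] that ts_kappa_subset k0 assms(4,8)
    by auto
  have complex: "solves_conf_oscillator T k0 k1 \<alpha> \<gamma> y \<longleftrightarrow>
      (\<exists>c1 c2 :: complex. \<forall>t\<in>T. y t = c1 * ?cos t + c2 * ?sin t)" for y
  proof -
    have "solves_conf_oscillator T k0 k1 \<alpha> \<gamma> y \<longleftrightarrow> (\<exists>a b. \<forall>t\<in>T. y t = a * ?p t + b * ?n t)"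
    proof (rule solves_conf_oscillator_iff[of T t0 k0 \<alpha> \<gamma> k1 ?p ?n])
      show "closed T" by (rule cl)
      show "t0 \<in> ts_kappa T" "\<gamma> \<noteq> 0" by (rule assms)+
      fix t
      show "k0 \<alpha> t \<noteq> 0" if "t \<in> T" using that by (rule k0)
      show "has_conf_deriv T k0 k1 \<alpha> ?p (\<i> * of_real \<gamma> * ?p t) t" if "t \<in> ts_kappa T"
        using that by (rule p)
      show "has_conf_deriv T k0 k1 \<alpha> ?n (- (\<i> * of_real \<gamma>) * ?n t) t" if "t \<in> ts_kappa T"
        using that by (rule n)
      show "?p t \<noteq> 0" "?n t \<noteq> 0"
        by (simp_all add: conf_exp_def delta_exp_def)
    qed
    then show ?thesis
      unfolding conf_cos_def conf_sin_def using exponential_span_eq_trig_span by (rule trans)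
  qed
  have cnj: "?n t = cnj (?p t)" if "t \<in> T" for t
    using that k0 by (intro conf_exp_cnj[OF assms(1) t0 _ _ assms(4,7)]) auto
  have real: "?cos t \<in> \<real>" "?sin t \<in> \<real>" if "t \<in> T" for t
    by (auto simp: conf_cos_def conf_sin_def cnj[OF that] complex_is_Real_iff)
  have "(solves_conf_oscillator T k0 k1 \<alpha> \<gamma> y \<and> (\<forall>t\<in>T. y t \<in> \<real>)) \<longleftrightarrow>
      (\<exists>c1 c2 :: real. \<forall>t\<in>T. y t = of_real c1 * ?cos t + of_real c2 * ?sin t)"
  proof (intro iffI conjI)
    assume "solves_conf_oscillator T k0 k1 \<alpha> \<gamma> y \<and> (\<forall>t\<in>T. y t \<in> \<real>)"
    then obtain c1 c2 where y: "\<And>t. t \<in> T \<Longrightarrow> y t = c1 * ?cos t + c2 * ?sin t"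
      and yr: "\<And>t. t \<in> T \<Longrightarrow> y t \<in> \<real>"
      unfolding complex by blast
    \<comment> \<open>real parts of the coefficients suffice, as cosine and sine are real\<close>
    have "y t = of_real (Re c1) * ?cos t + of_real (Re c2) * ?sin t" if "t \<in> T" for t
      using real[OF that] yr[OF that] y[OF that] by (simp add: complex_eq_iff complex_is_Real_iff)
    then show "\<exists>c1 c2 :: real. \<forall>t\<in>T. y t = of_real c1 * ?cos t + of_real c2 * ?sin t"
      by blast
  next
    assume ex: "\<exists>c1 c2 :: real. \<forall>t\<in>T. y t = of_real c1 * ?cos t + of_real c2 * ?sin t"
    then show "solves_conf_oscillator T k0 k1 \<alpha> \<gamma> y"
      unfolding complex by blast
    show "\<forall>t\<in>T. y t \<in> \<real>"
      using ex real by (auto intro!: Reals_add Reals_mult)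
  qed
  with complex show ?thesis by blast
qed

end
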